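(* In the setting described in the context, for each $n\in\mathbb N$ and $\xi_1,\dots,\xi_n\in\mathcal F(X)$, $$\rho(\xi_1)\cdots\rho(\xi_n)=\sum_{k=1}^n\int_{X^k}\big(\mathbf S(n,k)(\xi_1\odot\dots\odot\xi_n)\big)(x_1,\dots,x_k)\,{:}\rho(x_1)\cdots\rho(x_k){:}\,\sigma^{\otimes k}(dx_1\cdots dx_k).$$
   Context: Let $X$ be a locally compact Polish space, $\mathbb F\in\{\mathbb R,\mathbb C\}$, $M(X)$ the set of $\mathbb F$-valued Radon measures on $X$, $\mathcal F(X)$ the bounded measurable compactly supported functions $X\to\mathbb F$, and for $n\ge1$, $\mathcal F^{(n)}(X)$ the bounded measurable symmetric compactly supported functions on $X^n$; $\langle\mu,f\rangle:=\int f\,d\mu$; $\xi_1\odot\dots\odot\xi_n$ is the symmetrization of $\xi_1\otimes\dots\otimes\xi_n$. Fix $\sigma\in M(X)$. Let $V$ be a vector space and $a^+(\xi),a^-(\xi)$, $\xi\in\mathcal F(X)$, linear operators on $V$ depending linearly on $\xi$ and satisfying $[a^+(\varphi),a^+(\xi)]=[a^-(\varphi),a^-(\xi)]=0$, $[a^-(\varphi),a^+(\xi)]=\int_X\varphi\xi\,d\sigma$ (times identity), where $[A,B]=AB-BA$. Let $\rho(\xi)$, $\xi\in\mathcal F(X)$, be linear operators on $V$ depending linearly on $\xi$ and satisfying $[\rho(\varphi),\rho(\xi)]=0$, $[\rho(\varphi),a^+(\xi)]=a^+(\varphi\xi)$, $[a^-(\xi),\rho(\varphi)]=a^-(\varphi\xi)$.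 Wick products are defined recursively: $\int_X\xi(x){:}\rho(x){:}\,\sigma(dx):=\rho(\xi)$ and, for $n\ge2$, $$\int_{X^n}\xi_1(x_1)\cdots\xi_n(x_n){:}\rho(x_1)\cdots\rho(x_n){:}\,\sigma^{\otimes n}(dx) :=\rho(\xi_1)\int_{X^{n-1}}\xi_2(x_2)\cdots\xi_n(x_n){:}\rho(x_2)\cdots\rho(x_n){:}\,\sigma^{\otimes(n-1)}(dx)$$ $$-\sum_{i=2}^n\int_{X^{n-1}}\xi_2(x_2)\cdots(\xi_1\xi_i)(x_i)\cdots\xi_n(x_n){:}\rho(x_2)\cdots\rho(x_n){:}\,\sigma^{\otimes(n-1)}(dx),$$ extended linearly to all $f:X^n\to\mathbb F$ that are finite linear combinations of $\xi_1\otimes\dots\otimes\xi_n$, $\xi_j\in\mathcal F(X)$. For $\omega\in M(X)$, $(\omega)_k(dx_1\cdots dx_k)=\omega(dx_1)(\omega(dx_2)-\delta_{x_1}(dx_2))\cdots(\omega(dx_k)-\delta_{x_1}(dx_k)-\dots-\delta_{x_{k-1}}(dx_k))$; for $1\le k\le n$, $\mathbf S(n,k):\mathcal F^{(n)}(X)\to\mathcal F^{(k)}(X)$ are the linear operators uniquely determined by $\langle\omega^{\otimes n},f\rangle=\sum_{k=1}^n\langle(\omega)_k,\mathbf S(n,k)f\rangle$ for all $\omega\in M(X)$, $f\in\mathcal F^{(n)}(X)$. *)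

theory Defs
  imports "HOL-Analysis.Analysis"
begin

text \<open>
  The scalar field is a type \<open>'f :: {real_normed_field, euclidean_space}\<close>. By the theorem of
  Frobenius, a finite-dimensional commutative real division algebra is \<open>\<real>\<close> or \<open>\<complex>\<close>, and a
  multiplicative norm on it is the absolute value; so these classes describe exactly
  \<open>F \<in> {\<real>, \<complex>}\<close>.
\<close>

subsection \<open>Functions and measures\<close>

text \<open>
  A point of \<open>X\<^sup>n\<close> is an extensional function on \<open>{..<n}\<close>, i.e. coordinates are numbered from 0
  and \<open>X\<^sup>n = {..<n} \<rightarrow>\<^sub>E UNIV\<close>.
  The notions below are parametrised by a topology \<open>T\<close> and a measurable space \<open>M\<close>, so that they
  apply both to \<open>X\<close> and to \<open>X\<^sup>n\<close>.
\<close>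

abbreviation powtop :: "nat \<Rightarrow> (nat \<Rightarrow> 'a::topological_space) topology" where
  "powtop n \<equiv> product_topology (\<lambda>_. euclidean) {..<n}"

abbreviation powmeas :: "nat \<Rightarrow> (nat \<Rightarrow> 'a::topological_space) measure" where
  "powmeas n \<equiv> PiM {..<n} (\<lambda>_. borel)"

definition rc_sets :: "'b topology \<Rightarrow> 'b measure \<Rightarrow> 'b set set" where
  "rc_sets T M = {A \<in> sets M. \<exists>K. compactin T K \<and> A \<subseteq> K}"

text \<open>
  Functions on \<open>X\<^sup>n\<close> are represented by functions on the type \<open>nat \<Rightarrow> 'a\<close> that vanish outside
  \<open>X\<^sup>n\<close>; since compact sets are subsets of the topological space, the support condition
  enforces this, and the representation is unique.
\<close>

definition bmc :: "'b topology \<Rightarrow> 'b measure \<Rightarrow> ('b \<Rightarrow> 'f::real_normed_field) set" where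
  "bmc T M = {f \<in> borel_measurable M. bounded (range f) \<and>
     (\<exists>K. compactin T K \<and> (\<forall>x. x \<notin> K \<longrightarrow> f x = 0))}"

abbreviation bmc1 :: "('a::topological_space \<Rightarrow> 'f::real_normed_field) set" where
  "bmc1 \<equiv> bmc euclidean borel"

definition bmc_sym :: "nat \<Rightarrow> ((nat \<Rightarrow> 'a::topological_space) \<Rightarrow> 'f::real_normed_field) set" where
  "bmc_sym n = {f \<in> bmc (powtop n) (powmeas n). \<forall>\<pi>. \<pi> permutes {..<n} \<longrightarrow> (\<forall>x. f (x \<circ> \<pi>) = f x)}"

text \<open>
  An \<open>F\<close>-valued Radon measure is a countably additive set function on the relatively compact Borel
  sets (it need not extend to all Borel sets); its values elsewhere are irrelevant. On a
  locally compact Polish space local finiteness of the variation and inner regularity are automatic.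
\<close>

definition radon_measures :: "('a::topological_space set \<Rightarrow> 'f::real_normed_field) set" where
  "radon_measures = {\<mu>. \<forall>A :: nat \<Rightarrow> 'a set.
     range A \<subseteq> rc_sets euclidean borel \<and> disjoint_family A \<and> (\<Union>i. A i) \<in> rc_sets euclidean borel
     \<longrightarrow> (\<lambda>i. \<mu> (A i)) sums \<mu> (\<Union>i. A i)}"

text \<open>
  The integral of \<open>f\<close> against a set function \<open>\<mu>\<close> on a ring \<open>R\<close>: the common limit of the integrals
  of simple functions that approximate \<open>f\<close> uniformly and vanish wherever \<open>f\<close> does.
\<close>

definition simple_on :: "'b set set \<Rightarrow> ('b \<Rightarrow> 'f::real_normed_field) \<Rightarrow> bool" where
  "simple_on R s \<longleftrightarrow> finite (range s) \<and> (\<forall>v. v \<noteq> 0 \<longrightarrow> s -` {v} \<in> R)"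

definition simple_int :: "('b set \<Rightarrow> 'f) \<Rightarrow> ('b \<Rightarrow> 'f::real_normed_field) \<Rightarrow> 'f" where
  "simple_int \<mu> s = (\<Sum>v\<in>range s - {0}. v * \<mu> (s -` {v}))"

definition ring_int :: "'b set set \<Rightarrow> ('b set \<Rightarrow> 'f) \<Rightarrow> ('b \<Rightarrow> 'f::real_normed_field) \<Rightarrow> 'f" where
  "ring_int R \<mu> f = (THE I. \<forall>s :: nat \<Rightarrow> 'b \<Rightarrow> 'f.
     (\<forall>m. simple_on R (s m)) \<and> (\<forall>m x. f x = 0 \<longrightarrow> s m x = 0) \<and> uniform_limit UNIV s f sequentially
     \<longrightarrow> (\<lambda>m. simple_int \<mu> (s m)) \<longlonglongrightarrow> I)"

abbreviation meas_int :: "('a::topological_space set \<Rightarrow> 'f) \<Rightarrow> ('a \<Rightarrow> 'f::real_normed_field) \<Rightarrow> 'f" where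
  "meas_int \<equiv> ring_int (rc_sets euclidean borel)"

abbreviation pow_int ::
  "nat \<Rightarrow> ((nat \<Rightarrow> 'a::topological_space) set \<Rightarrow> 'f) \<Rightarrow> ((nat \<Rightarrow> 'a) \<Rightarrow> 'f::real_normed_field) \<Rightarrow> 'f" where
  "pow_int n \<equiv> ring_int (rc_sets (powtop n) (powmeas n))"

text \<open>
  \<open>iter_int \<kappa> n f\<close> is the iterated integral of \<open>f\<close> against
  \<open>\<kappa>\<^sub>0(dx\<^sub>0) \<kappa>\<^sub>1(x\<^sub>0; dx\<^sub>1) \<dots> \<kappa>\<^sub>n\<^sub>-\<^sub>1(x\<^sub>0,\<dots>,x\<^sub>n\<^sub>-\<^sub>2; dx\<^sub>n\<^sub>-\<^sub>1)\<close>, the last variable being integrated first.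
  The point \<open>\<lambda>_. undefined\<close> is the unique element of \<open>X\<^sup>0\<close>.
\<close>

primrec iter_int :: "(nat \<Rightarrow> (nat \<Rightarrow> 'a::topological_space) \<Rightarrow> 'a set \<Rightarrow> 'f) \<Rightarrow> nat \<Rightarrow>
    ((nat \<Rightarrow> 'a) \<Rightarrow> 'f::real_normed_field) \<Rightarrow> 'f" where
  "iter_int \<kappa> 0 f = f (\<lambda>_. undefined)"
| "iter_int \<kappa> (Suc n) f = iter_int \<kappa> n (\<lambda>x. meas_int (\<kappa> n x) (\<lambda>y. f (x(n := y))))"

definition tensor_power :: "('a::topological_space set \<Rightarrow> 'f::real_normed_field) \<Rightarrow> nat \<Rightarrow>
    (nat \<Rightarrow> 'a) set \<Rightarrow> 'f" where
  "tensor_power \<omega> n A = iter_int (\<lambda>_ _. \<omega>) n (indicator A)"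

definition falling_factorial :: "('a::topological_space set \<Rightarrow> 'f::real_normed_field) \<Rightarrow> nat \<Rightarrow>
    (nat \<Rightarrow> 'a) set \<Rightarrow> 'f" where
  "falling_factorial \<omega> n A =
     iter_int (\<lambda>j x B. \<omega> B - (\<Sum>i<j. indicator B (x i))) n (indicator A)"

subsection \<open>Tensor products and Stirling operators\<close>

definition tensor :: "('a \<Rightarrow> 'f) list \<Rightarrow> (nat \<Rightarrow> 'a) \<Rightarrow> 'f::real_normed_field" where
  "tensor \<xi>s x = (if x \<in> extensional {..<length \<xi>s} then \<Prod>i<length \<xi>s. (\<xi>s ! i) (x i) else 0)"

definition symmetrize :: "nat \<Rightarrow> ((nat \<Rightarrow> 'a) \<Rightarrow> 'f) \<Rightarrow> (nat \<Rightarrow> 'a) \<Rightarrow> 'f::real_normed_field" where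
  "symmetrize n f x = (\<Sum>\<pi> | \<pi> permutes {..<n}. f (x \<circ> \<pi>)) / fact n"

definition sym_tensor :: "('a \<Rightarrow> 'f) list \<Rightarrow> (nat \<Rightarrow> 'a) \<Rightarrow> 'f::real_normed_field" where
  "sym_tensor \<xi>s = symmetrize (length \<xi>s) (tensor \<xi>s)"

definition stirling_operators ::
  "(nat \<Rightarrow> nat \<Rightarrow> ((nat \<Rightarrow> 'a::topological_space) \<Rightarrow> 'f) \<Rightarrow> (nat \<Rightarrow> 'a) \<Rightarrow> 'f::real_normed_field) \<Rightarrow> bool"
where
  "stirling_operators S \<longleftrightarrow>
     (\<forall>n\<ge>1. \<forall>k\<in>{1..n}.
        (\<forall>f\<in>bmc_sym n. S n k f \<in> bmc_sym k) \<and>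
        (\<forall>f\<in>bmc_sym n. \<forall>g\<in>bmc_sym n. S n k (\<lambda>x. f x + g x) = (\<lambda>x. S n k f x + S n k g x)) \<and>
        (\<forall>c. \<forall>f\<in>bmc_sym n. S n k (\<lambda>x. c * f x) = (\<lambda>x. c * S n k f x))) \<and>
     (\<forall>n\<ge>1. \<forall>\<omega>\<in>radon_measures. \<forall>f\<in>bmc_sym n.
        pow_int n (tensor_power \<omega> n) f = (\<Sum>k=1..n. pow_int k (falling_factorial \<omega> k) (S n k f)))"

subsection \<open>Operators and Wick products\<close>

definition linear_operators ::
  "('f \<Rightarrow> 'v \<Rightarrow> 'v) \<Rightarrow> (('a::topological_space \<Rightarrow> 'f::real_normed_field) \<Rightarrow> 'v \<Rightarrow> 'v::ab_group_add) \<Rightarrow> bool"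
where
  "linear_operators smul A \<longleftrightarrow>
     (\<forall>\<xi>\<in>bmc1. Vector_Spaces.linear smul smul (A \<xi>)) \<and>
     (\<forall>\<phi>\<in>bmc1. \<forall>\<xi>\<in>bmc1. A (\<lambda>x. \<phi> x + \<xi> x) = (\<lambda>v. A \<phi> v + A \<xi> v)) \<and>
     (\<forall>c. \<forall>\<xi>\<in>bmc1. A (\<lambda>x. c * \<xi> x) = (\<lambda>v. smul c (A \<xi> v)))"

definition commutator :: "('v \<Rightarrow> 'v) \<Rightarrow> ('v \<Rightarrow> 'v) \<Rightarrow> 'v \<Rightarrow> 'v::ab_group_add" where
  "commutator A B = (\<lambda>v. A (B v) - B (A v))"

text \<open>
  \<open>wick \<rho> [\<xi>\<^sub>1, \<dots>, \<xi>\<^sub>n]\<close> is the Wick product integrated against \<open>\<xi>\<^sub>1 \<otimes> \<dots> \<otimes> \<xi>\<^sub>n\<close>. The value for the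
  empty list is only a convention.
\<close>

function wick :: "(('a \<Rightarrow> 'f) \<Rightarrow> 'v \<Rightarrow> 'v) \<Rightarrow> ('a \<Rightarrow> 'f::real_normed_field) list \<Rightarrow> 'v \<Rightarrow> 'v::ab_group_add"
where
  "wick \<rho> [] = id"
| "wick \<rho> [\<xi>] = \<rho> \<xi>"
| "wick \<rho> (\<xi> # \<eta> # \<eta>s) = (\<lambda>v. \<rho> \<xi> (wick \<rho> (\<eta> # \<eta>s) v) -
     (\<Sum>i<length (\<eta> # \<eta>s). wick \<rho> ((\<eta> # \<eta>s)[i := (\<lambda>x. \<xi> x * ((\<eta> # \<eta>s) ! i) x)]) v))"
  by pat_completeness auto
termination by (relation "Wellfounded.measure (\<lambda>(\<rho>, \<xi>s). length \<xi>s)") (auto simp del: list_update.simps)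

text \<open>
  Linear extension of \<open>wick\<close> to finite linear combinations of tensor products of \<open>k\<close> functions;
  the description is proper because the value does not depend on the chosen combination.
\<close>

definition wick_int :: "('f \<Rightarrow> 'v \<Rightarrow> 'v) \<Rightarrow> (('a::topological_space \<Rightarrow> 'f) \<Rightarrow> 'v \<Rightarrow> 'v) \<Rightarrow> nat \<Rightarrow>
    ((nat \<Rightarrow> 'a) \<Rightarrow> 'f::real_normed_field) \<Rightarrow> 'v \<Rightarrow> 'v::ab_group_add" where
  "wick_int smul \<rho> k f = (THE W. \<exists>ts :: ('f \<times> ('a \<Rightarrow> 'f) list) list.
     (\<forall>(c, \<xi>s)\<in>set ts. length \<xi>s = k \<and> set \<xi>s \<subseteq> bmc1) \<and>
     f = (\<lambda>x. \<Sum>(c, \<xi>s)\<leftarrow>ts. c * tensor \<xi>s x) \<and>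
     W = (\<lambda>v. \<Sum>(c, \<xi>s)\<leftarrow>ts. smul c (wick \<rho> \<xi>s v)))"

end

theory Submission
  imports Defs
begin

text \<open>
  The recursion for Wick products reads
  \<open>\<rho>(\<xi>) :\<eta>\<^sub>1\<dots>\<eta>\<^sub>k: = :\<xi>\<eta>\<^sub>1\<dots>\<eta>\<^sub>k: + \<Sum>\<^sub>i :\<eta>\<^sub>1\<dots>(\<xi>\<eta>\<^sub>i)\<dots>\<eta>\<^sub>k:\<close>, so a product of operators is the sum,
  over all set partitions of its factors, of the Wick product of the block products.
  The same identity for the scalar operators \<open>\<xi> \<mapsto> \<langle>\<omega>, \<xi>\<rangle>\<close>, with \<open>\<omega>\<close> a finite sum of point masses,
  expresses \<open>\<omega>\<^sup>\<otimes>\<^sup>n\<close> through the falling factorials of \<open>\<omega>\<close>. Comparison with the defining property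
  of the Stirling operators, for \<open>\<omega>\<close> with \<open>1, 2, \<dots>\<close> atoms (repetitions allowed) in turn, shows that
  they send a symmetrized tensor product to the symmetrized sum of the tensor products of the block
  products. Wick products are symmetric, so the symmetrization disappears upon integration.
\<close>

subsection \<open>Symmetry of Wick products\<close>

definition absorb :: "('a \<Rightarrow> 'f::times) \<Rightarrow> ('a \<Rightarrow> 'f) list \<Rightarrow> nat \<Rightarrow> ('a \<Rightarrow> 'f) list" where
  "absorb \<xi> \<eta>s i = \<eta>s[i := (\<lambda>x. \<xi> x * (\<eta>s ! i) x)]"

lemma length_absorb [simp]: "length (absorb \<xi> \<eta>s i) = length \<eta>s"
  by (simp add: absorb_def)

text \<open>Only closure under products, additivity and commutation enter here. The locale therefore
  covers both the given operators \<open>\<rho>\<close> on \<open>bmc1\<close> and, with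
  \<open>UNIV\<close> for \<open>A\<close>, the scalar operators of
  \<open>point_operator\<close>.\<close>

locale commuting_operators =
  fixes A :: "('a \<Rightarrow> 'f::real_normed_field) set" and \<rho> :: "('a \<Rightarrow> 'f) \<Rightarrow> 'v \<Rightarrow> 'v::ab_group_add"
  assumes mult_closed: "\<phi> \<in> A \<Longrightarrow> \<xi> \<in> A \<Longrightarrow> (\<lambda>x. \<phi> x * \<xi> x) \<in> A"
    and \<rho>_add: "\<xi> \<in> A \<Longrightarrow> \<rho> \<xi> (v + w) = \<rho> \<xi> v + \<rho> \<xi> w"
    and \<rho>_commute: "\<phi> \<in> A \<Longrightarrow> \<xi> \<in> A \<Longrightarrow> \<rho> \<phi> (\<rho> \<xi> v) = \<rho> \<xi> (\<rho> \<phi> v)"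
begin

lemma absorb_closed:
  assumes "\<xi> \<in> A" "set \<eta>s \<subseteq> A" "i < length \<eta>s"
  shows "set (absorb \<xi> \<eta>s i) \<subseteq> A"
  using assms mult_closed set_update_subset_insert[of \<eta>s i] nth_mem[of i \<eta>s]
  unfolding absorb_def by blast

lemma \<rho>_0: "\<xi> \<in> A \<Longrightarrow> \<rho> \<xi> 0 = 0"
  using \<rho>_add[of \<xi> 0 0] by simp

lemma \<rho>_diff: "\<xi> \<in> A \<Longrightarrow> \<rho> \<xi> (v - w) = \<rho> \<xi> v - \<rho> \<xi> w"
  using \<rho>_add[of \<xi> "v - w" w] by (simp add: algebra_simps)

lemma \<rho>_sum: "\<xi> \<in> A \<Longrightarrow> \<rho> \<xi> (\<Sum>i\<in>I. f i) = (\<Sum>i\<in>I. \<rho> \<xi> (f i))"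
  by (induction I rule: infinite_finite_induct) (auto simp: \<rho>_0 \<rho>_add)

lemma \<rho>_sum_list: "\<xi> \<in> A \<Longrightarrow> \<rho> \<xi> (\<Sum>x\<leftarrow>xs. f x) = (\<Sum>x\<leftarrow>xs. \<rho> \<xi> (f x))"
  by (induction xs) (auto simp: \<rho>_0 \<rho>_add)

text \<open>The convention \<open>wick \<rho> [] = id\<close> makes the clause for singletons an
  instance of the general recursion, with an empty sum.\<close>

lemma wick_Cons:
  "wick \<rho> (\<xi> # \<eta>s) v = \<rho> \<xi> (wick \<rho> \<eta>s v) - (\<Sum>i<length \<eta>s. wick \<rho> (absorb \<xi> \<eta>s i) v)"
  by (cases \<eta>s) (simp_all add: absorb_def)

text \<open>Unfolding the recursion for both leading factors gives an expression symmetric in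
  \<open>\<xi>\<close> and \<open>\<eta>\<close>: the operators commute, the merged factor is a
  commutative product, the two single sums trade places, and absorbing two factors does not depend
  on the order.\<close>

lemma wick_swap:
  assumes "\<xi> \<in> A" "\<eta> \<in> A" "set \<eta>s \<subseteq> A"
  shows "wick \<rho> (\<xi> # \<eta> # \<eta>s) v = wick \<rho> (\<eta> # \<xi> # \<eta>s) v"
proof -
  define W where "W \<zeta>s = wick \<rho> \<zeta>s v" for \<zeta>s
  let ?n = "length \<eta>s"
  have expand: "W (\<xi> # \<eta> # \<eta>s) = \<rho> \<xi> (\<rho> \<eta> (W \<eta>s)) - (\<Sum>i<?n. \<rho> \<xi> (W (absorb \<eta> \<eta>s i)))
      - W ((\<lambda>x. \<xi> x * \<eta> x) # \<eta>s) - (\<Sum>i<?n. \<rho> \<eta> (W (absorb \<xi> \<eta>s i)))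
      + (\<Sum>i<?n. \<Sum>j<?n. W (absorb \<eta> (absorb \<xi> \<eta>s i) j))"
    if "\<xi> \<in> A" "\<eta> \<in> A" for \<xi> \<eta>
  proof -
    have "W (\<xi> # \<eta> # \<eta>s) = \<rho> \<xi> (W (\<eta> # \<eta>s)) - (\<Sum>i<Suc ?n. W (absorb \<xi> (\<eta> # \<eta>s) i))"
      unfolding W_def by (subst wick_Cons) simp
    \<comment> \<open>The term \<open>i = 0\<close> merges the two leading factors; the other terms
      leave \<open>\<eta>\<close> in front and are unfolded once more.\<close>
    also have "(\<Sum>i<Suc ?n. W (absorb \<xi> (\<eta> # \<eta>s) i))
        = W ((\<lambda>x. \<xi> x * \<eta> x) # \<eta>s) + (\<Sum>i<?n. W (\<eta> # absorb \<xi> \<eta>s i))"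
      by (subst sum.lessThan_Suc_shift) (simp add: absorb_def)
    also have "(\<Sum>i<?n. W (\<eta> # absorb \<xi> \<eta>s i))
        = (\<Sum>i<?n. \<rho> \<eta> (W (absorb \<xi> \<eta>s i))) - (\<Sum>i<?n. \<Sum>j<?n. W (absorb \<eta> (absorb \<xi> \<eta>s i) j))"
      by (simp add: W_def wick_Cons sum_subtractf)
    also have "\<rho> \<xi> (W (\<eta> # \<eta>s)) = \<rho> \<xi> (\<rho> \<eta> (W \<eta>s)) - (\<Sum>i<?n. \<rho> \<xi> (W (absorb \<eta> \<eta>s i)))"
      using that by (simp add: W_def wick_Cons \<rho>_diff \<rho>_sum)
    finally show ?thesis by (simp add: algebra_simps)
  qed
  \<comment> \<open>For \<open>i = j\<close> both factors enter the same entry, and only the order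
    of multiplication changes.\<close>
  have "absorb \<eta> (absorb \<xi> \<eta>s i) j = absorb \<xi> (absorb \<eta> \<eta>s j) i" if "i < ?n" "j < ?n" for i j
    using that by (cases "i = j") (auto simp: absorb_def list_update_swap mult.left_commute)
  then have "(\<Sum>i<?n. \<Sum>j<?n. W (absorb \<eta> (absorb \<xi> \<eta>s i) j))
      = (\<Sum>i<?n. \<Sum>j<?n. W (absorb \<xi> (absorb \<eta> \<eta>s j) i))"
    by (intro sum.cong refl) auto
  also have "\<dots> = (\<Sum>j<?n. \<Sum>i<?n. W (absorb \<xi> (absorb \<eta> \<eta>s j) i))"
    by (rule sum.swap)
  finally have "W (\<xi> # \<eta> # \<eta>s) = W (\<eta> # \<xi> # \<eta>s)"
    unfolding expand[OF assms(1,2)] expand[OF assms(2,1)] \<rho>_commute[OF assms(1,2)]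
      mult.commute[of "\<xi> _" "\<eta> _"]
    by (simp only: diff_diff_eq add_ac)
  then show ?thesis by (simp add: W_def)
qed

text \<open>Induction step for a fixed head: absorbing \<open>\<xi>\<close> at position
  \<open>i\<close> of the rearranged tail is a rearrangement of absorbing it at
  \<open>\<pi> i\<close> of the original tail, so the subtracted terms are only reindexed.\<close>

lemma wick_Cons_cong:
  assumes IH: "\<And>\<zeta>s \<zeta>s'. length \<zeta>s = length \<eta>s \<Longrightarrow> set \<zeta>s \<subseteq> A \<Longrightarrow> mset \<zeta>s = mset \<zeta>s' \<Longrightarrow> wick \<rho> \<zeta>s v = wick \<rho> \<zeta>s' v"
    and "\<xi> \<in> A" "set \<eta>s \<subseteq> A" "mset \<eta>s = mset \<eta>s'"
  shows "wick \<rho> (\<xi> # \<eta>s) v = wick \<rho> (\<xi> # \<eta>s') v"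
proof -
  let ?n = "length \<eta>s"
  obtain \<pi> where \<pi>: "\<pi> permutes {..<?n}" "permute_list \<pi> \<eta>s = \<eta>s'"
    by (metis assms(4) mset_eq_permutation)
  have "wick \<rho> (absorb \<xi> \<eta>s' i) v = wick \<rho> (absorb \<xi> \<eta>s (\<pi> i)) v" if i: "i < ?n" for i
  proof -
    have \<pi>i: "\<pi> i < ?n" using permutes_in_image[OF \<pi>(1), of i] i by simp
    have "absorb \<xi> \<eta>s' i = permute_list \<pi> (absorb \<xi> \<eta>s (\<pi> i))"
    proof (rule nth_equalityI)
      fix j assume "j < length (absorb \<xi> \<eta>s' i)"
      then have j: "j < ?n" using \<pi> by auto
      have \<pi>j: "\<pi> j < ?n" using permutes_in_image[OF \<pi>(1), of j] j by simp
      have "\<pi> i = \<pi> j \<longleftrightarrow> i = j" using permutes_inj[OF \<pi>(1)] by (auto dest: injD)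
      then show "absorb \<xi> \<eta>s' i ! j = permute_list \<pi> (absorb \<xi> \<eta>s (\<pi> i)) ! j"
        using i j \<pi>i \<pi>j \<pi> by (auto simp: absorb_def permute_list_nth nth_list_update)
    qed (use \<pi> in auto)
    then have "mset (absorb \<xi> \<eta>s (\<pi> i)) = mset (absorb \<xi> \<eta>s' i)"
      using \<pi>(1) by simp
    then show ?thesis
      using IH[of "absorb \<xi> \<eta>s (\<pi> i)" "absorb \<xi> \<eta>s' i"] absorb_closed[OF assms(2,3) \<pi>i] by simp
  qed
  then have "(\<Sum>i<?n. wick \<rho> (absorb \<xi> \<eta>s' i) v) = (\<Sum>i<?n. wick \<rho> (absorb \<xi> \<eta>s (\<pi> i)) v)"
    by simp
  also have "\<dots> = (\<Sum>i<?n. wick \<rho> (absorb \<xi> \<eta>s i) v)"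
    using sum.permute[OF \<pi>(1), of "\<lambda>i. wick \<rho> (absorb \<xi> \<eta>s i) v"] by (simp add: comp_def)
  finally show ?thesis
    using IH[of \<eta>s \<eta>s'] assms(3,4) mset_eq_length[OF assms(4)] by (simp add: wick_Cons)
qed

text \<open>Induction on the length. The head of one list is brought to the front of the other,
  after which the two tails have the same multiset.\<close>

lemma wick_mset_cong:
  assumes "set \<eta>s \<subseteq> A" "mset \<eta>s = mset \<eta>s'"
  shows "wick \<rho> \<eta>s v = wick \<rho> \<eta>s' v"
  using assms
proof (induction "length \<eta>s" arbitrary: \<eta>s \<eta>s')
  case (Suc n)
  then obtain \<xi> \<zeta>s where \<eta>s: "\<eta>s = \<xi> # \<zeta>s" by (cases \<eta>s) auto
  have tail: "wick \<rho> (\<phi> # \<chi>s) v = wick \<rho> (\<phi> # \<chi>s') v"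
    if "\<phi> \<in> A" "set \<chi>s \<subseteq> A" "mset \<chi>s = mset \<chi>s'" "length \<chi>s = n" for \<phi> \<chi>s \<chi>s'
    using Suc.hyps(1) that by (intro wick_Cons_cong) auto
  have "\<xi> \<in> set \<eta>s'" using Suc.prems \<eta>s by (metis list.set_intros(1) mset_eq_setD)
  then obtain us vs where \<eta>s': "\<eta>s' = us @ \<xi> # vs" by (meson split_list)
  have len: "length (us @ vs) = n"
    using Suc.hyps(2) mset_eq_length[OF Suc.prems(2)] \<eta>s' by simp
  have sub: "\<xi> \<in> A" "set us \<subseteq> A" "set vs \<subseteq> A"
    using Suc.prems \<eta>s' mset_eq_setD[OF Suc.prems(2)] by auto
  \<comment> \<open>A rearrangement of the tail moves \<open>\<xi>\<close> to second place, and
    \<open>wick_swap\<close> exchanges it with the head \<open>u\<close>.\<close>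
  have "wick \<rho> (us @ \<xi> # vs) v = wick \<rho> (\<xi> # us @ vs) v"
  proof (cases us)
    case (Cons u us')
    have "wick \<rho> (u # us' @ \<xi> # vs) v = wick \<rho> (u # \<xi> # us' @ vs) v"
      using sub len Cons by (intro tail) auto
    also have "\<dots> = wick \<rho> (\<xi> # u # us' @ vs) v"
      using sub Cons by (intro wick_swap) auto
    finally show ?thesis using Cons by simp
  qed simp
  also have "\<dots> = wick \<rho> (\<xi> # \<zeta>s) v"
    using sub len Suc.prems(2) \<eta>s \<eta>s' by (intro tail) auto
  finally show ?case using \<eta>s \<eta>s' by simp
qed auto

end

subsection \<open>Products of commuting operators\<close>

text \<open>Each entry belongs to one set partition of the factors and lists the products over its
  blocks: a new factor opens a block of its own or joins an existing one. A list rather than a set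
  is used because different partitions can give the same functions and must be counted
  separately.\<close>

primrec block_products :: "('a \<Rightarrow> 'f::times) list \<Rightarrow> ('a \<Rightarrow> 'f) list list" where
  "block_products [] = [[]]"
| "block_products (\<xi> # \<xi>s) =
     concat (map (\<lambda>\<eta>s. (\<xi> # \<eta>s) # map (absorb \<xi> \<eta>s) [0..<length \<eta>s]) (block_products \<xi>s))"

lemma block_products_Cons_iff:
  "\<eta>s \<in> set (block_products (\<xi> # \<xi>s)) \<longleftrightarrow>
    (\<exists>\<zeta>s\<in>set (block_products \<xi>s). \<eta>s = \<xi> # \<zeta>s \<or> (\<exists>i<length \<zeta>s. \<eta>s = absorb \<xi> \<zeta>s i))"
  by (simp add: image_iff atLeast0LessThan Bex_def) blast

lemma sum_list_concat_map: "(\<Sum>y\<leftarrow>concat (map g xs). f y) = (\<Sum>x\<leftarrow>xs. \<Sum>y\<leftarrow>g x. f y)"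
  for f :: "_ \<Rightarrow> 'b::comm_monoid_add"
  by (induction xs) simp_all

text \<open>The number of blocks lies between 1 and \<open>n\<close> for \<open>n \<ge> 1\<close>,
  which is the range of \<open>k\<close> in the theorem.\<close>

lemma length_block_products:
  "\<eta>s \<in> set (block_products \<xi>s) \<Longrightarrow> length \<eta>s \<le> length \<xi>s \<and> (\<xi>s \<noteq> [] \<longrightarrow> \<eta>s \<noteq> [])"
proof (induction \<xi>s arbitrary: \<eta>s)
  case (Cons \<xi> \<xi>s)
  from Cons.prems obtain \<zeta>s where "\<zeta>s \<in> set (block_products \<xi>s)"
    and "\<eta>s = \<xi> # \<zeta>s \<or> (\<exists>i<length \<zeta>s. \<eta>s = absorb \<xi> \<zeta>s i)"
    unfolding block_products_Cons_iff by blast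
  then show ?case using Cons.IH[of \<zeta>s] by (auto simp: absorb_def)
qed auto

lemma (in commuting_operators) block_products_closed:
  "set \<xi>s \<subseteq> A \<Longrightarrow> \<eta>s \<in> set (block_products \<xi>s) \<Longrightarrow> set \<eta>s \<subseteq> A"
proof (induction \<xi>s arbitrary: \<eta>s)
  case (Cons \<xi> \<xi>s)
  from Cons.prems(2) obtain \<zeta>s where "\<zeta>s \<in> set (block_products \<xi>s)"
    and "\<eta>s = \<xi> # \<zeta>s \<or> (\<exists>i<length \<zeta>s. \<eta>s = absorb \<xi> \<zeta>s i)"
    unfolding block_products_Cons_iff by blast
  then show ?case using Cons.IH[of \<zeta>s] Cons.prems(1) absorb_closed[of \<xi> \<zeta>s] by auto
qed auto

text \<open>Solved for the operator product, the recursion turns one Wick product into precisely the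
  lists that \<open>block_products\<close> generates from it.\<close>

lemma (in commuting_operators) foldr_eq_sum_wick:
  "set \<xi>s \<subseteq> A \<Longrightarrow> foldr (\<circ>) (map \<rho> \<xi>s) id v = (\<Sum>\<eta>s\<leftarrow>block_products \<xi>s. wick \<rho> \<eta>s v)"
proof (induction \<xi>s)
  case (Cons \<xi> \<xi>s)
  have "\<rho> \<xi> (wick \<rho> \<eta>s v) = wick \<rho> (\<xi> # \<eta>s) v + (\<Sum>\<zeta>s\<leftarrow>map (absorb \<xi> \<eta>s) [0..<length \<eta>s]. wick \<rho> \<zeta>s v)"
    for \<eta>s
    by (simp add: wick_Cons comp_def interv_sum_list_conv_sum_set_nat atLeast0LessThan)
  then show ?case
    using Cons by (simp add: \<rho>_sum_list sum_list_concat_map comp_def)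
qed simp

subsection \<open>Multilinearity and the integral of Wick products\<close>

definition words :: "nat set \<Rightarrow> nat \<Rightarrow> nat list set" where
  "words J n = {js. set js \<subseteq> J \<and> length js = n}"

lemma finite_words: "finite J \<Longrightarrow> finite (words J n)"
  by (simp add: words_def finite_lists_length_eq)

lemma words_0 [simp]: "words J 0 = {[]}"
  by (auto simp: words_def)

lemma sum_words_Suc: "(\<Sum>js\<in>words J (Suc n). f js) = (\<Sum>j\<in>J. \<Sum>js\<in>words J n. f (j # js))"
proof -
  have "(\<Sum>js\<in>words J (Suc n). f js) = (\<Sum>(j, js)\<in>J \<times> words J n. f (j # js))"
    by (rule sum.reindex_bij_witness[of _ "\<lambda>(j, js). j # js" "\<lambda>js. (hd js, tl js)"])
      (auto simp: words_def length_Suc_conv)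
  then show ?thesis by (simp add: sum.cartesian_product)
qed

text \<open>The word \<open>js\<close> selects the coordinates from the points \<open>y\<close>; the
  value \<open>undefined\<close> beyond its length keeps the result extensional, hence an element of
  the power of the space.\<close>

definition point :: "(nat \<Rightarrow> 'a) \<Rightarrow> nat list \<Rightarrow> nat \<Rightarrow> 'a" where
  "point y js i = (if i < length js then y (js ! i) else undefined)"

lemma tensor_point:
  "length \<xi>s = length js \<Longrightarrow> tensor \<xi>s (point y js) = (\<Prod>i<length js. (\<xi>s ! i) (y (js ! i)))"
  by (simp add: tensor_def point_def extensional_def)

locale linear_wick_operators = commuting_operators A \<rho> + vector_space smul
  for A :: "('a::topological_space \<Rightarrow> 'f::real_normed_field) set" and \<rho> :: "('a \<Rightarrow> 'f) \<Rightarrow> 'v \<Rightarrow> 'v::ab_group_add"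
    and smul :: "'f \<Rightarrow> 'v \<Rightarrow> 'v" +
  assumes zero_closed: "(\<lambda>x. 0) \<in> A"
    and add_closed: "\<phi> \<in> A \<Longrightarrow> \<xi> \<in> A \<Longrightarrow> (\<lambda>x. \<phi> x + \<xi> x) \<in> A"
    and scale_closed: "\<xi> \<in> A \<Longrightarrow> (\<lambda>x. c * \<xi> x) \<in> A"
    and \<rho>_arg_add: "\<phi> \<in> A \<Longrightarrow> \<xi> \<in> A \<Longrightarrow> \<rho> (\<lambda>x. \<phi> x + \<xi> x) v = \<rho> \<phi> v + \<rho> \<xi> v"
    and \<rho>_arg_scale: "\<xi> \<in> A \<Longrightarrow> \<rho> (\<lambda>x. c * \<xi> x) v = smul c (\<rho> \<xi> v)"
begin

lemma sum_closed: "(\<And>j. j \<in> J \<Longrightarrow> e j \<in> A) \<Longrightarrow> (\<lambda>x. \<Sum>j\<in>J. c j * e j x) \<in> A"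
  by (induction J rule: infinite_finite_induct) (auto simp: zero_closed add_closed scale_closed)

text \<open>By symmetry the modified factor may stand in front, before a tail that is one shorter.
  This lets the inductions for linearity treat the first factor only.\<close>

lemma wick_absorb:
  assumes "\<xi> \<in> A" "set \<eta>s \<subseteq> A" "i < length \<eta>s"
  shows "wick \<rho> (absorb \<xi> \<eta>s i) v
    = wick \<rho> ((\<lambda>x. \<xi> x * (\<eta>s ! i) x) # take i \<eta>s @ drop (Suc i) \<eta>s) v"
  using absorb_closed[OF assms] assms(3)
  by (intro wick_mset_cong) (auto simp: absorb_def upd_conv_take_nth_drop)

lemma take_drop_closed:
  assumes "set \<eta>s \<subseteq> A" "i < length \<eta>s"
  shows "set (take i \<eta>s @ drop (Suc i) \<eta>s) \<subseteq> A" "length (take i \<eta>s @ drop (Suc i) \<eta>s) = length \<eta>s - 1"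
    "\<eta>s ! i \<in> A"
  using assms set_take_subset[of i \<eta>s] set_drop_subset[of "Suc i" \<eta>s] by auto

text \<open>\<open>\<rho>\<close> is additive in its argument, and every subtracted term has a head
  that is again a sum, before a shorter tail.\<close>

lemma wick_Cons_add:
  assumes "\<phi> \<in> A" "\<xi> \<in> A" "set \<eta>s \<subseteq> A"
  shows "wick \<rho> ((\<lambda>x. \<phi> x + \<xi> x) # \<eta>s) v = wick \<rho> (\<phi> # \<eta>s) v + wick \<rho> (\<xi> # \<eta>s) v"
  using assms
proof (induction "length \<eta>s" arbitrary: \<phi> \<xi> \<eta>s rule: less_induct)
  case less
  have "wick \<rho> (absorb (\<lambda>x. \<phi> x + \<xi> x) \<eta>s i) v = wick \<rho> (absorb \<phi> \<eta>s i) v + wick \<rho> (absorb \<xi> \<eta>s i) v"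
    if i: "i < length \<eta>s" for i
  proof -
    note td = take_drop_closed[OF less.prems(3) i]
    show ?thesis
      using less.prems i td
      by (simp add: wick_absorb add_closed distrib_right)
        (intro less.hyps; auto simp: mult_closed)
  qed
  then show ?case
    using less.prems by (simp add: wick_Cons \<rho>_arg_add sum.distrib algebra_simps)
qed

lemma wick_Cons_scale:
  assumes "\<xi> \<in> A" "set \<eta>s \<subseteq> A"
  shows "wick \<rho> ((\<lambda>x. c * \<xi> x) # \<eta>s) v = smul c (wick \<rho> (\<xi> # \<eta>s) v)"
  using assms
proof (induction "length \<eta>s" arbitrary: \<xi> \<eta>s rule: less_induct)
  case less
  have "wick \<rho> (absorb (\<lambda>x. c * \<xi> x) \<eta>s i) v = smul c (wick \<rho> (absorb \<xi> \<eta>s i) v)"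
    if i: "i < length \<eta>s" for i
  proof -
    note td = take_drop_closed[OF less.prems(2) i]
    show ?thesis
      using less.prems i td
      by (simp add: wick_absorb scale_closed mult.assoc)
        (intro less.hyps; auto simp: mult_closed)
  qed
  then show ?case
    using less.prems by (simp add: wick_Cons \<rho>_arg_scale scale_right_diff_distrib scale_sum_right)
qed

lemma wick_Cons_0:
  assumes "set \<eta>s \<subseteq> A"
  shows "wick \<rho> ((\<lambda>x. 0) # \<eta>s) v = 0"
  using wick_Cons_scale[OF zero_closed assms, of 0 v] by simp

lemma wick_Cons_sum:
  assumes "finite J" "\<And>j. j \<in> J \<Longrightarrow> e j \<in> A" "set \<eta>s \<subseteq> A"
  shows "wick \<rho> ((\<lambda>x. \<Sum>j\<in>J. c j * e j x) # \<eta>s) v = (\<Sum>j\<in>J. smul (c j) (wick \<rho> (e j # \<eta>s) v))"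
  using assms
proof (induction J rule: finite_induct)
  case (insert j J)
  then show ?case
    by (simp add: wick_Cons_add[OF scale_closed sum_closed] wick_Cons_scale)
qed (simp add: wick_Cons_0)

text \<open>Multilinear expansion, one factor at a time; the prefix \<open>\<zeta>s\<close> collects
  the factors already replaced by some \<open>e j\<close>. The coefficients are values of the tensor
  product at points built from \<open>p\<close>.\<close>

lemma wick_expand:
  assumes "\<And>j. j \<in> J \<Longrightarrow> e j \<in> A" and "finite J"
    and "\<And>\<xi>. \<xi> \<in> set \<xi>s \<Longrightarrow> \<xi> = (\<lambda>x. \<Sum>j\<in>J. \<xi> (p j) * e j x)"
    and "set \<zeta>s \<subseteq> A"
  shows "wick \<rho> (\<zeta>s @ \<xi>s) v = (\<Sum>js\<in>words J (length \<xi>s).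
    smul (\<Prod>i<length \<xi>s. (\<xi>s ! i) (p (js ! i))) (wick \<rho> (\<zeta>s @ map e js) v))"
  using assms(3,4)
proof (induction \<xi>s arbitrary: \<zeta>s)
  case (Cons \<xi> \<xi>s)
  have \<xi>: "\<xi> = (\<lambda>x. \<Sum>j\<in>J. \<xi> (p j) * e j x)" using Cons.prems by simp
  have in_A: "\<eta> \<in> A" if "\<eta> \<in> set (\<xi> # \<xi>s)" for \<eta>
    by (subst Cons.prems(1)[OF that]) (rule sum_closed[OF assms(1)])
  then have sub: "set (\<zeta>s @ \<xi>s) \<subseteq> A" "\<xi> \<in> A" using Cons.prems by auto
  have "wick \<rho> (\<zeta>s @ \<xi> # \<xi>s) v = wick \<rho> (\<xi> # \<zeta>s @ \<xi>s) v"
    using sub by (intro wick_mset_cong) auto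
  also have "\<dots> = (\<Sum>j\<in>J. smul (\<xi> (p j)) (wick \<rho> (e j # \<zeta>s @ \<xi>s) v))"
    by (subst \<xi>) (rule wick_Cons_sum[OF assms(2,1) sub(1)])
  also have "\<dots> = (\<Sum>j\<in>J. smul (\<xi> (p j)) (wick \<rho> ((\<zeta>s @ [e j]) @ \<xi>s) v))"
    using sub assms(1)
    by (intro sum.cong refl arg_cong2[where f = smul] wick_mset_cong) auto
  also have "\<dots> = (\<Sum>j\<in>J. smul (\<xi> (p j)) (\<Sum>js\<in>words J (length \<xi>s).
    smul (\<Prod>i<length \<xi>s. (\<xi>s ! i) (p (js ! i))) (wick \<rho> ((\<zeta>s @ [e j]) @ map e js) v)))"
    using Cons.prems assms(1)
    by (intro sum.cong refl arg_cong2[where f = smul] Cons.IH) auto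
  finally show ?case
    by (simp add: sum_words_Suc scale_sum_right prod.lessThan_Suc_shift del: prod.lessThan_Suc)
qed simp

text \<open>In the manner of Newton interpolation, the functions are added one at a time, and a new
  node is introduced only when the present nodes fail to reproduce the new function.\<close>

lemma interpolation:
  assumes "finite G" "G \<subseteq> A"
  shows "\<exists>r p e. (\<forall>j<r. e j \<in> A) \<and> (\<forall>g\<in>G. g = (\<lambda>x. \<Sum>j<(r::nat). g (p j) * e j x))"
  using assms
proof (induction G rule: finite_induct)
  case empty
  show ?case by (rule exI[of _ 0]) simp
next
  case (insert h G)
  from insert.prems have "G \<subseteq> A" by simp
  from insert.IH[OF this] obtain r p e
    where rpe: "(\<forall>j<r. e j \<in> A) \<and> (\<forall>g\<in>G. g = (\<lambda>x. \<Sum>j<(r::nat). g (p j) * e j x))"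
    by (elim exE)
  note e = rpe[THEN conjunct1, rule_format] and G = rpe[THEN conjunct2, rule_format]
  \<comment> \<open>The interpolation error of the new function at the old nodes. If it is not
    identically zero, a point where it does not vanish becomes the next node.\<close>
  define h' where "h' x = h x - (\<Sum>j<r. h (p j) * e j x)" for x
  have combine: ?case
    if "\<And>j. j < r' \<Longrightarrow> e' j \<in> A" "h = (\<lambda>x. \<Sum>j<(r'::nat). h (p' j) * e' j x)"
      "\<And>g. g \<in> G \<Longrightarrow> g = (\<lambda>x. \<Sum>j<r'. g (p' j) * e' j x)" for r' p' e'
  proof (intro exI conjI allI impI ballI)
    fix g assume "g \<in> insert h G"
    then show "g = (\<lambda>x. \<Sum>j<r'. g (p' j) * e' j x)"
      by (rule insertE) (erule ssubst, rule that(2), erule that(3))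
  qed (rule that(1))
  show ?case
  proof (cases "\<forall>x. h' x = 0")
    case True
    then have h: "h = (\<lambda>x. \<Sum>j<r. h (p j) * e j x)"
      unfolding h'_def right_minus_eq by (intro ext) (erule spec)
    show ?thesis by (rule combine[of r e p, OF e h G])
  next
    case False
    then obtain q where q: "h' q \<noteq> 0" by blast
    have "(\<lambda>x. \<Sum>j<r. h (p j) * e j x) \<in> A" using e by (intro sum_closed) auto
    moreover have "h \<in> A" using insert.prems by simp
    ultimately have "(\<lambda>x. h x + (-1) * (\<Sum>j<r. h (p j) * e j x)) \<in> A"
      by (intro add_closed[OF _ scale_closed])
    moreover have "h' = (\<lambda>x. h x + (-1) * (\<Sum>j<r. h (p j) * e j x))"
      by (intro ext) (simp add: h'_def)
    ultimately have "h' \<in> A" by (simp only:)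
    define e0 where "e0 x = inverse (h' q) * h' x" for x
    have e0: "e0 \<in> A" unfolding e0_def using \<open>h' \<in> A\<close> by (rule scale_closed)
    \<comment> \<open>As \<open>e0\<close> is 1 at \<open>q\<close>, the corrected old functions
      vanish there. The coefficient of \<open>e0\<close> thus becomes the old interpolation error at
      \<open>q\<close>: zero for members of \<open>G\<close>, and \<open>h' q\<close> for
      \<open>h\<close>.\<close>
    define e' where "e' j = (if j < r then (\<lambda>x. e j x + (- e j q) * e0 x) else e0)" for j
    define p' where "p' = p(r := q)"
    have e': "e' j \<in> A" for j
      unfolding e'_def using e0 e by (cases "j < r") (simp_all only: if_True if_False add_closed scale_closed)
    have sum': "(\<Sum>j<Suc r. g (p' j) * e' j x)
        = (\<Sum>j<r. g (p j) * e j x) + (g q - (\<Sum>j<r. g (p j) * e j q)) * e0 x" for g x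
      by (simp add: p'_def e'_def algebra_simps sum_subtractf sum_distrib_left)
    show ?thesis
    proof (rule combine[of "Suc r" e' p'])
      show "e' j \<in> A" for j by (rule e')
      show "h = (\<lambda>x. \<Sum>j<Suc r. h (p' j) * e' j x)"
        unfolding sum' e0_def h'_def[symmetric] mult.assoc[symmetric] right_inverse[OF q]
        by (intro ext) (simp add: h'_def)
      show "g = (\<lambda>x. \<Sum>j<Suc r. g (p' j) * e' j x)" if "g \<in> G" for g
        using fun_cong[OF G[OF that], symmetric] unfolding sum' by (intro ext) simp
    qed
  qed
qed

text \<open>The interpolation lemma expresses a combination of Wick products through the values of the
  corresponding combination of tensor products at finitely many points, hence well-definedness.\<close>

lemma wick_int_eq:
  assumes valid: "\<forall>(c, \<xi>s)\<in>set ts. length \<xi>s = k \<and> set \<xi>s \<subseteq> bmc1" and A: "A = bmc1"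
  shows "wick_int smul \<rho> k (\<lambda>x. \<Sum>(c, \<xi>s)\<leftarrow>ts. c * tensor \<xi>s x)
    = (\<lambda>v. \<Sum>(c, \<xi>s)\<leftarrow>ts. smul c (wick \<rho> \<xi>s v))"
  unfolding wick_int_def
proof (rule the_equality, goal_cases)
  case 1
  show ?case using valid by (intro exI[of _ ts]) auto
next
  case (2 W)
  then obtain ts' where valid': "\<forall>(c, \<xi>s)\<in>set ts'. length \<xi>s = k \<and> set \<xi>s \<subseteq> bmc1"
    and eq: "(\<lambda>x. \<Sum>(c, \<xi>s)\<leftarrow>ts. c * tensor \<xi>s x) = (\<lambda>x. \<Sum>(c, \<xi>s)\<leftarrow>ts'. c * tensor \<xi>s x)"
    and W: "W = (\<lambda>v. \<Sum>(c, \<xi>s)\<leftarrow>ts'. smul c (wick \<rho> \<xi>s v))"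
    by (elim exE conjE) (rule that)
  \<comment> \<open>The functions of both representations are interpolated together, so that the
    same nodes and the same \<open>e\<close> serve for both sums.\<close>
  define G where "G = (\<Union>(c, \<xi>s)\<in>set ts \<union> set ts'. set \<xi>s)"
  have "finite G" "G \<subseteq> A" using valid valid' A by (auto simp: G_def)
  from interpolation[OF this] obtain r p e
    where rpe: "(\<forall>j<r. e j \<in> A) \<and> (\<forall>g\<in>G. g = (\<lambda>x. \<Sum>j<(r::nat). g (p j) * e j x))"
    by (elim exE)
  note e = rpe[THEN conjunct1, rule_format] and G = rpe[THEN conjunct2, rule_format]
  have expand: "(\<Sum>(c, \<xi>s)\<leftarrow>us. smul c (wick \<rho> \<xi>s v)) = (\<Sum>js\<in>words {..<r} k.
      smul (\<Sum>(c, \<xi>s)\<leftarrow>us. c * tensor \<xi>s (point p js)) (wick \<rho> (map e js) v))"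
    if "set us \<subseteq> set ts \<union> set ts'" for us v
    using that
  proof (induction us)
    case (Cons t us)
    obtain c \<xi>s where t: "t = (c, \<xi>s)" by (cases t)
    have \<xi>s: "length \<xi>s = k" "set \<xi>s \<subseteq> G"
      using Cons.prems valid valid' by (auto simp: t G_def)
    have "wick \<rho> \<xi>s v = (\<Sum>js\<in>words {..<r} k.
        smul (\<Prod>i<k. (\<xi>s ! i) (p (js ! i))) (wick \<rho> (map e js) v))"
      using wick_expand[of "{..<r}" e \<xi>s p "[]" v] e G \<xi>s by auto
    also have "\<dots> = (\<Sum>js\<in>words {..<r} k. smul (tensor \<xi>s (point p js)) (wick \<rho> (map e js) v))"
      using \<xi>s by (intro sum.cong) (auto simp: words_def tensor_point)
    finally show ?case
      using Cons by (simp add: t scale_sum_right scale_left_distrib sum.distrib)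
  qed simp
  show ?case
    unfolding W expand[OF Un_upper1] expand[OF Un_upper2] using fun_cong[OF eq] by simp
qed

end

subsection \<open>Bounded measurable functions with compact support\<close>

lemma bmcE:
  assumes "f \<in> bmc T M"
  obtains B K where "f \<in> borel_measurable M" "\<And>x. norm (f x) \<le> B" "compactin T K"
    "\<And>x. x \<notin> K \<Longrightarrow> f x = 0"
  using assms that unfolding bmc_def bounded_iff by blast

lemma bmcI:
  assumes "f \<in> borel_measurable M" "\<And>x. norm (f x) \<le> B" "compactin T K" "\<And>x. x \<notin> K \<Longrightarrow> f x = 0"
  shows "f \<in> bmc T M"
  using assms unfolding bmc_def bounded_iff by blast

lemma bmc_symD: "f \<in> bmc_sym n \<Longrightarrow> \<pi> permutes {..<n} \<Longrightarrow> f (x \<circ> \<pi>) = f x"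
  unfolding bmc_sym_def by blast

lemma bmc_0: "(\<lambda>x. 0) \<in> bmc T M"
  by (rule bmcI[of _ _ 0 _ "{}"]) auto

lemma bmc_add:
  fixes f :: "'b \<Rightarrow> 'f::{real_normed_field, second_countable_topology}"
  assumes "f \<in> bmc T M" "g \<in> bmc T M"
  shows "(\<lambda>x. f x + g x) \<in> bmc T M"
proof -
  obtain B K where f: "f \<in> borel_measurable M" "\<And>x. norm (f x) \<le> B" "compactin T K"
    "\<And>x. x \<notin> K \<Longrightarrow> f x = 0" using bmcE[OF assms(1)] by metis
  obtain C L where g: "g \<in> borel_measurable M" "\<And>x. norm (g x) \<le> C" "compactin T L"
    "\<And>x. x \<notin> L \<Longrightarrow> g x = 0" using bmcE[OF assms(2)] by metis
  show ?thesis
    using f g by (intro bmcI[of _ _ "B + C" _ "K \<union> L"]) (auto intro: norm_add_rule_thm compactin_Un)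
qed

lemma bmc_mult:
  fixes f :: "'b \<Rightarrow> 'f::{real_normed_field, second_countable_topology}"
  assumes "f \<in> bmc T M" "g \<in> bmc T M"
  shows "(\<lambda>x. f x * g x) \<in> bmc T M"
proof -
  obtain B K where f: "f \<in> borel_measurable M" "\<And>x. norm (f x) \<le> B" "compactin T K"
    "\<And>x. x \<notin> K \<Longrightarrow> f x = 0" using bmcE[OF assms(1)] by metis
  obtain C where g: "g \<in> borel_measurable M" "\<And>x. norm (g x) \<le> C" using bmcE[OF assms(2)] by metis
  have "norm (f x * g x) \<le> B * C" for x
    unfolding norm_mult using order_trans[OF norm_ge_zero f(2)] f(2) g(2) by (intro mult_mono) auto
  then show ?thesis
    using f g by (intro bmcI[of _ _ "B * C" _ K]) auto
qed

lemma bmc_scale: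
  fixes f :: "'b \<Rightarrow> 'f::{real_normed_field, second_countable_topology}"
  assumes "f \<in> bmc T M"
  shows "(\<lambda>x. c * f x) \<in> bmc T M"
proof -
  obtain B K where f: "f \<in> borel_measurable M" "\<And>x. norm (f x) \<le> B" "compactin T K"
    "\<And>x. x \<notin> K \<Longrightarrow> f x = 0" using bmcE[OF assms] by metis
  show ?thesis
    using f by (intro bmcI[of _ _ "norm c * B" _ K]) (auto simp: norm_mult intro: mult_left_mono)
qed

lemma bmc_sum:
  fixes f :: "'c \<Rightarrow> 'b \<Rightarrow> 'f::{real_normed_field, second_countable_topology}"
  shows "(\<And>i. i \<in> I \<Longrightarrow> f i \<in> bmc T M) \<Longrightarrow> (\<lambda>x. \<Sum>i\<in>I. f i x) \<in> bmc T M"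
  by (induction I rule: infinite_finite_induct) (auto simp: bmc_0 bmc_add)

lemma space_powmeas: "space (powmeas n) = {..<n} \<rightarrow>\<^sub>E UNIV"
  by (simp add: space_PiM)

lemma compactin_powtop_subset: "compactin (powtop n) K \<Longrightarrow> K \<subseteq> space (powmeas n)"
  using compactin_subset_topspace by (fastforce simp: space_powmeas)

text \<open>The product of the compact supports of the factors is compact, and the extensionality
  test in \<open>tensor\<close> makes the function vanish outside it.\<close>

lemma tensor_in_bmc:
  fixes \<xi>s :: "('a::topological_space \<Rightarrow> 'f::{real_normed_field, second_countable_topology}) list"
  assumes "set \<xi>s \<subseteq> bmc1"
  shows "tensor \<xi>s \<in> bmc (powtop (length \<xi>s)) (powmeas (length \<xi>s))"
proof -
  let ?n = "length \<xi>s"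
  define P where "P i B K \<longleftrightarrow> \<xi>s ! i \<in> borel_measurable borel \<and> (\<forall>x. norm ((\<xi>s ! i) x) \<le> B) \<and>
      compact K \<and> (\<forall>x. x \<notin> K \<longrightarrow> (\<xi>s ! i) x = 0)" for i B K
  have "\<forall>i\<in>{..<?n}. \<exists>B K. P i B K"
  proof
    fix i assume "i \<in> {..<?n}"
    then have "\<xi>s ! i \<in> bmc1" using assms by auto
    from bmcE[OF this] show "\<exists>B K. P i B K" unfolding P_def by (metis compactin_euclidean_iff)
  qed
  from bchoice[OF this] obtain B where "\<forall>i\<in>{..<?n}. \<exists>K. P i (B i) K" by blast
  from bchoice[OF this] obtain K where "\<forall>i\<in>{..<?n}. P i (B i) (K i)" by blast
  then have i: "\<And>i. i < ?n \<Longrightarrow> \<xi>s ! i \<in> borel_measurable borel"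
    "\<And>i x. i < ?n \<Longrightarrow> norm ((\<xi>s ! i) x) \<le> B i" "\<And>i. i < ?n \<Longrightarrow> compact (K i)"
    "\<And>i x. i < ?n \<Longrightarrow> x \<notin> K i \<Longrightarrow> (\<xi>s ! i) x = 0"
    unfolding P_def by simp_all
  have B: "0 \<le> B i" if "i < ?n" for i
    using i(2)[OF that] norm_ge_zero order_trans by blast
  show ?thesis
  proof (rule bmcI)
    have "(\<lambda>x. \<Prod>i<?n. (\<xi>s ! i) (x i)) \<in> borel_measurable (powmeas ?n)"
    proof (rule borel_measurable_prod)
      fix i assume "i \<in> {..<?n}"
      then show "(\<lambda>x. (\<xi>s ! i) (x i)) \<in> borel_measurable (powmeas ?n)"
        using measurable_compose[OF measurable_component_singleton[of i "{..<?n}" "\<lambda>_. borel"] i(1)] by auto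
    qed
    then show "tensor \<xi>s \<in> borel_measurable (powmeas ?n)"
      by (rule measurable_cong[THEN iffD2, rotated]) (auto simp: tensor_def space_powmeas PiE_def)
    show "norm (tensor \<xi>s x) \<le> (\<Prod>i<?n. B i)" for x
      unfolding tensor_def using B
      by (auto simp: prod_norm[symmetric] intro!: prod_mono prod_nonneg i)
    show "compactin (powtop ?n) (Pi\<^sub>E {..<?n} K)"
      by (rule compactin_PiE[THEN iffD2]) (auto simp: i)
    show "tensor \<xi>s x = 0" if "x \<notin> Pi\<^sub>E {..<?n} K" for x
      using that i(4) by (force simp: tensor_def PiE_def Pi_def)
  qed
qed

text \<open>Factor \<open>i\<close> is evaluated at coordinate \<open>\<pi> i\<close>, so coordinate
  \<open>j\<close> meets factor \<open>inv \<pi> j\<close>.\<close>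

lemma tensor_comp_permutation:
  assumes "\<pi> permutes {..<length \<xi>s}"
  shows "tensor \<xi>s (x \<circ> \<pi>) = tensor (permute_list (inv \<pi>) \<xi>s) x"
proof -
  let ?n = "length \<xi>s"
  have inv: "inv \<pi> permutes {..<?n}" using assms by (rule permutes_inv)
  have out: "\<pi> i = i" if "\<not> i < ?n" for i using assms that by (auto simp: permutes_def)
  have in': "\<pi> i < ?n \<longleftrightarrow> i < ?n" for i using permutes_in_image[OF assms, of i] by simp
  have "x \<circ> \<pi> \<in> extensional {..<?n} \<longleftrightarrow> x \<in> extensional {..<?n}"
    by (auto simp: extensional_def out)
  moreover have "(\<Prod>i<?n. (\<xi>s ! i) (x (\<pi> i))) = (\<Prod>i<?n. (\<xi>s ! inv \<pi> i) (x i))"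
    using prod.permute[OF assms, of "\<lambda>i. (\<xi>s ! inv \<pi> i) (x i)"]
    by (simp add: comp_def permutes_inverses(2)[OF assms])
  ultimately show ?thesis
    using inv by (simp add: tensor_def permute_list_nth)
qed

lemma symmetrize_permutation:
  assumes "\<tau> permutes {..<n}"
  shows "symmetrize n f (x \<circ> \<tau>) = symmetrize n f x"
proof -
  have "(\<Sum>\<pi> | \<pi> permutes {..<n}. f (x \<circ> \<tau> \<circ> \<pi>)) = (\<Sum>\<pi> | \<pi> permutes {..<n}. f (x \<circ> \<pi>))"
    by (rule sum.reindex_bij_witness[of _ "\<lambda>\<pi>. inv \<tau> \<circ> \<pi>" "\<lambda>\<pi>. \<tau> \<circ> \<pi>"])
      (auto simp: assms permutes_compose permutes_inv comp_assoc permutes_inv_o[OF assms]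
        comp_assoc[symmetric, of "inv \<tau>" \<tau>] comp_assoc[symmetric, of \<tau> "inv \<tau>"])
  then show ?thesis by (simp add: symmetrize_def)
qed

lemma sym_tensor_in_bmc_sym:
  fixes \<xi>s :: "('a::topological_space \<Rightarrow> 'f::{real_normed_field, second_countable_topology}) list"
  assumes "set \<xi>s \<subseteq> bmc1"
  shows "sym_tensor \<xi>s \<in> bmc_sym (length \<xi>s)"
proof -
  let ?n = "length \<xi>s"
  have "sym_tensor \<xi>s = (\<lambda>x. (1 / fact ?n) *
      (\<Sum>\<pi> | \<pi> permutes {..<?n}. tensor (permute_list (inv \<pi>) \<xi>s) x))"
    by (intro ext) (simp add: sym_tensor_def symmetrize_def tensor_comp_permutation)
  moreover have "tensor (permute_list (inv \<pi>) \<xi>s) \<in> bmc (powtop ?n) (powmeas ?n)"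
    if "\<pi> permutes {..<?n}" for \<pi>
    using tensor_in_bmc[of "permute_list (inv \<pi>) \<xi>s"] assms permutes_inv[OF that] by simp
  ultimately have "sym_tensor \<xi>s \<in> bmc (powtop ?n) (powmeas ?n)"
    by (simp only:) (intro bmc_scale bmc_sum; simp)
  then show ?thesis
    by (simp add: bmc_sym_def sym_tensor_def symmetrize_permutation)
qed

subsection \<open>Integration against finite sums of point masses\<close>

text \<open>Without such a sequence the description in \<open>ring_int\<close> would hold vacuously
  for every value, so uniqueness of the integral depends on this property.\<close>

definition approximable :: "'b set set \<Rightarrow> ('b \<Rightarrow> 'f::real_normed_field) \<Rightarrow> bool" where
  "approximable R f \<longleftrightarrow> (\<exists>s :: nat \<Rightarrow> 'b \<Rightarrow> 'f. (\<forall>m. simple_on R (s m)) \<and>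
     (\<forall>m x. f x = 0 \<longrightarrow> s m x = 0) \<and> uniform_limit UNIV s f sequentially)"

lemma simple_on_approximable: "simple_on R f \<Longrightarrow> approximable R f"
  unfolding approximable_def by (rule exI[of _ "\<lambda>_. f"]) (simp add: uniform_limit_iff)

text \<open>For simple functions this is the decomposition into level sets. A finite sum of point
  evaluations is continuous under uniform limits, which settles the general case.\<close>

lemma ring_int_atomic:
  fixes \<mu> :: "'b set \<Rightarrow> 'f::real_normed_field"
  assumes "finite P"
    and \<mu>: "\<And>B. B \<in> R \<Longrightarrow> \<mu> B = (\<Sum>p\<in>P. a p * indicator B (z p))"
    and "approximable R f"
  shows "ring_int R \<mu> f = (\<Sum>p\<in>P. a p * f (z p))"
proof -
  have simple: "simple_int \<mu> s = (\<Sum>p\<in>P. a p * s (z p))" if s: "simple_on R s" for s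
  proof -
    have fin: "finite (range s)" using s by (simp add: simple_on_def)
    have level_sum: "(\<Sum>v\<in>range s - {0}. v * indicator (s -` {v}) x) = s x" for x
    proof -
      have "(\<Sum>v\<in>range s - {0}. v * indicator (s -` {v}) x) = (\<Sum>v\<in>range s - {0}. if v = s x then s x else 0)"
        by (intro sum.cong) (auto simp: indicator_def)
      also have "\<dots> = s x" using fin by (subst sum.delta) auto
      finally show ?thesis .
    qed
    have "simple_int \<mu> s = (\<Sum>v\<in>range s - {0}. v * (\<Sum>p\<in>P. a p * indicator (s -` {v}) (z p)))"
      unfolding simple_int_def using s \<mu> by (intro sum.cong) (auto simp: simple_on_def)
    also have "\<dots> = (\<Sum>p\<in>P. a p * (\<Sum>v\<in>range s - {0}. v * indicator (s -` {v}) (z p)))"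
      unfolding sum_distrib_left by (subst sum.swap) (simp add: mult_ac)
    finally show ?thesis by (simp add: level_sum)
  qed
  have lim: "(\<lambda>m. simple_int \<mu> (s m)) \<longlonglongrightarrow> (\<Sum>p\<in>P. a p * f (z p))"
    if "\<forall>m. simple_on R (s m)" "uniform_limit UNIV s f sequentially" for s
  proof -
    have "(\<lambda>m. \<Sum>p\<in>P. a p * s m (z p)) \<longlonglongrightarrow> (\<Sum>p\<in>P. a p * f (z p))"
      by (intro tendsto_sum tendsto_mult_left tendsto_uniform_limitI[OF that(2)] UNIV_I)
    then show ?thesis using that(1) by (simp add: simple)
  qed
  obtain s where s: "\<forall>m. simple_on R (s m)" "\<forall>m x. f x = 0 \<longrightarrow> s m x = 0"
    "uniform_limit UNIV s f sequentially"
    using assms(3) unfolding approximable_def by blast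
  show ?thesis
    unfolding ring_int_def
  proof (rule the_equality)
    fix I
    assume "\<forall>s. (\<forall>m. simple_on R (s m)) \<and> (\<forall>m x. f x = 0 \<longrightarrow> s m x = 0) \<and> uniform_limit UNIV s f sequentially
      \<longrightarrow> (\<lambda>m. simple_int \<mu> (s m)) \<longlonglongrightarrow> I"
    with s have "(\<lambda>m. simple_int \<mu> (s m)) \<longlonglongrightarrow> I" by blast
    then show "I = (\<Sum>p\<in>P. a p * f (z p))" using lim[OF s(1,3)] by (rule LIMSEQ_unique)
  qed (use lim in blast)
qed

text \<open>Approximation by rounding every coordinate down to a multiple of \<open>1 / (m + 1)\<close>; this maps
  \<open>0\<close> to \<open>0\<close> and has finite range on bounded sets.\<close>

lemma bmc_approximable:
  fixes f :: "'b \<Rightarrow> 'f::{real_normed_field, euclidean_space}"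
  assumes f: "f \<in> bmc T M" and sub: "\<And>K. compactin T K \<Longrightarrow> K \<subseteq> space M"
  shows "approximable (rc_sets T M) f"
proof -
  obtain B K where K: "f \<in> borel_measurable M" "\<And>x. norm (f x) \<le> B" "compactin T K"
    "\<And>x. x \<notin> K \<Longrightarrow> f x = 0" using bmcE[OF f] by metis
  define s where "s m x = (\<Sum>b\<in>Basis. (of_int \<lfloor>real (Suc m) * (f x \<bullet> b)\<rfloor> / real (Suc m)) *\<^sub>R b)" for m x
  have s0: "f x = 0 \<Longrightarrow> s m x = 0" for m x by (simp add: s_def)
  have "simple_on (rc_sets T M) (s m)" for m
  proof -
    define L where "L = \<lceil>real (Suc m) * B\<rceil> + 1"
    have "\<lfloor>real (Suc m) * (f x \<bullet> b)\<rfloor> \<in> {-L..L}" if "b \<in> Basis" for x b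
    proof -
      have "\<bar>f x \<bullet> b\<bar> \<le> B" using Basis_le_norm[OF that, of "f x"] K(2)[of x] by linarith
      then have "\<bar>real (Suc m) * (f x \<bullet> b)\<bar> \<le> real (Suc m) * B"
        unfolding abs_mult by (intro mult_mono) auto
      then show ?thesis unfolding L_def by (simp del: of_nat_Suc) linarith
    qed
    then have "range (s m) \<subseteq> (\<lambda>g. \<Sum>b\<in>Basis. (of_int (g b) / real (Suc m)) *\<^sub>R b) ` (Basis \<rightarrow>\<^sub>E {-L..L})"
      unfolding s_def
      by (auto intro!: image_eqI[of _ _ "\<lambda>b\<in>Basis. \<lfloor>real (Suc m) * (f _ \<bullet> b)\<rfloor>"] sum.cong simp del: of_nat_Suc)
    moreover have "finite ((Basis :: 'f set) \<rightarrow>\<^sub>E {-L..L})" by (intro finite_PiE) auto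
    ultimately have "finite (range (s m))" by (meson finite_imageI finite_subset)
    moreover have "s m -` {v} \<in> rc_sets T M" if "v \<noteq> 0" for v
    proof -
      have K': "s m -` {v} \<subseteq> K" using K(4) s0 that by fastforce
      have "s m \<in> borel_measurable M" unfolding s_def using K(1) by measurable
      then have "s m -` {v} \<inter> space M \<in> sets M" by (rule measurable_sets) simp
      then show ?thesis using K' sub[OF K(3)] K(3) by (auto simp: rc_sets_def Int_absorb2)
    qed
    ultimately show ?thesis by (simp add: simple_on_def)
  qed
  moreover have "uniform_limit UNIV s f sequentially"
  proof (rule uniform_limitI)
    fix e :: real assume "e > 0"
    have bound: "dist (s m x) (f x) \<le> real DIM('f) / real (Suc m)" for m x
    proof -
      have "s m x - f x = (\<Sum>b\<in>Basis. (of_int \<lfloor>real (Suc m) * (f x \<bullet> b)\<rfloor> / real (Suc m) - f x \<bullet> b) *\<^sub>R b)"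
        unfolding s_def scaleR_left_diff_distrib sum_subtractf euclidean_representation ..
      also have "norm \<dots> \<le> (\<Sum>b\<in>(Basis :: 'f set). 1 / real (Suc m))"
      proof (rule sum_norm_le)
        fix b :: 'f assume b: "b \<in> Basis"
        have "of_int \<lfloor>real (Suc m) * (f x \<bullet> b)\<rfloor> / real (Suc m) - f x \<bullet> b
            = (of_int \<lfloor>real (Suc m) * (f x \<bullet> b)\<rfloor> - real (Suc m) * (f x \<bullet> b)) / real (Suc m)"
          by (simp add: diff_divide_distrib del: of_nat_Suc)
        also have "\<bar>\<dots>\<bar> \<le> 1 / real (Suc m)"
          unfolding abs_divide by (intro frac_le) (auto simp del: of_nat_Suc, linarith)
        finally show "norm ((of_int \<lfloor>real (Suc m) * (f x \<bullet> b)\<rfloor> / real (Suc m) - f x \<bullet> b) *\<^sub>R b) \<le> 1 / real (Suc m)"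
          using b by (simp del: of_nat_Suc)
      qed
      finally show ?thesis by (simp add: dist_norm)
    qed
    have "(\<lambda>m. real DIM('f) * inverse (real (Suc m))) \<longlonglongrightarrow> real DIM('f) * 0"
      by (intro tendsto_intros LIMSEQ_inverse_real_of_nat)
    then have "\<forall>\<^sub>F m in sequentially. real DIM('f) * inverse (real (Suc m)) < e"
      using \<open>e > 0\<close> by (intro order_tendstoD(2)) auto
    then show "\<forall>\<^sub>F m in sequentially. \<forall>x\<in>UNIV. dist (s m x) (f x) < e"
      by eventually_elim (metis bound divide_inverse order_le_less_trans)
  qed
  ultimately show ?thesis unfolding approximable_def using s0 by (intro exI[of _ s]) auto
qed

text \<open>A class that contains the indicators of relatively compact sets and is stable under
  integrating out the last variable against atoms. Vanishing is required only inside the space: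
  \<open>f (x(n := y))\<close> ignores the old value of \<open>x\<close> at \<open>n\<close>, so it
  may be nonzero at a non-extensional \<open>x\<close>.\<close>

definition simple_supported :: "nat \<Rightarrow> ((nat \<Rightarrow> 'a::topological_space) \<Rightarrow> 'f::real_normed_field) \<Rightarrow> bool" where
  "simple_supported n f \<longleftrightarrow> simple_function (powmeas n) f \<and>
     (\<exists>K. compactin (powtop n) K \<and> (\<forall>x\<in>space (powmeas n) - K. f x = 0))"

lemma measurable_fun_upd_powmeas:
  assumes "q \<in> measurable (powmeas n) borel"
  shows "(\<lambda>x. x(n := q x)) \<in> measurable (powmeas n) (powmeas (Suc n))"
proof -
  have "(\<lambda>x. (\<lambda>(f, y). f(n := y)) (x, q x)) \<in> measurable (powmeas n) (PiM (insert n {..<n}) (\<lambda>_. borel))"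
    using assms by (intro measurable_compose[OF _ measurable_add_dim] measurable_Pair) auto
  then show ?thesis by (simp add: lessThan_Suc)
qed

lemma measurable_fun_upd_coordinate:
  assumes "x \<in> space (powmeas n)"
  shows "(\<lambda>y. x(n := y)) \<in> measurable borel (powmeas (Suc n))"
proof -
  have "(\<lambda>y. (\<lambda>(f, y). f(n := y)) (x, y)) \<in> measurable borel (PiM (insert n {..<n}) (\<lambda>_. borel))"
    using assms by (intro measurable_compose[OF _ measurable_add_dim] measurable_Pair) auto
  then show ?thesis by (simp add: lessThan_Suc)
qed

text \<open>The slice is supported in the projection of \<open>K\<close> to the last coordinate, so
  each inner integral is one of a simple function.\<close>

lemma simple_supported_slice:
  fixes f :: "(nat \<Rightarrow> 'a::topological_space) \<Rightarrow> 'f::real_normed_field"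
  assumes "simple_supported (Suc n) f" "x \<in> space (powmeas n)"
  shows "simple_on (rc_sets euclidean borel) (\<lambda>y. f (x(n := y)))"
proof -
  note upd = measurable_fun_upd_coordinate[OF assms(2)]
  obtain K where K: "compactin (powtop (Suc n)) K" "\<forall>x\<in>space (powmeas (Suc n)) - K. f x = 0"
    using assms(1) unfolding simple_supported_def by blast
  have sf: "simple_function borel (\<lambda>y. f (x(n := y)))"
    using assms(1) simple_function_comp[OF upd, of f] by (simp add: simple_supported_def)
  have comp: "compactin euclidean ((\<lambda>x. x n) ` K)"
    using K(1) by (rule image_compactin) (auto intro: continuous_map_product_projection)
  have "(\<lambda>y. f (x(n := y))) -` {v} \<subseteq> (\<lambda>x. x n) ` K" if "v \<noteq> 0" for v
  proof
    fix y assume "y \<in> (\<lambda>y. f (x(n := y))) -` {v}"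
    then have "x(n := y) \<in> K"
      using K(2) measurable_space[OF upd, of y] that by auto
    then show "y \<in> (\<lambda>x. x n) ` K" by (intro image_eqI[of _ _ "x(n := y)"]) auto
  qed
  then show ?thesis
    using simple_functionD[OF sf] comp by (fastforce simp: simple_on_def rc_sets_def)
qed

text \<open>The projection of \<open>K\<close> to the first \<open>n\<close> coordinates is compact.
  The atoms may depend measurably on the earlier coordinates, as the falling factorials
  demand.\<close>

lemma simple_supported_step:
  assumes "simple_supported (Suc n) f" and q: "\<And>p. p \<in> P \<Longrightarrow> q p \<in> measurable (powmeas n) borel"
  shows "simple_supported n (\<lambda>x. \<Sum>p\<in>P. a p * f (x(n := q p x)))"
proof -
  obtain K where K: "compactin (powtop (Suc n)) K" "\<forall>x\<in>space (powmeas (Suc n)) - K. f x = 0"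
    using assms(1) unfolding simple_supported_def by blast
  have "simple_function (powmeas n) (\<lambda>x. \<Sum>p\<in>P. a p * f (x(n := q p x)))"
    using assms(1) q
    by (intro simple_function_sum simple_function_compose1[of _ _ "\<lambda>v. _ * v"]
        simple_function_comp[OF measurable_fun_upd_powmeas]) (auto simp: simple_supported_def)
  moreover have "compactin (powtop n) ((\<lambda>x. restrict x {..<n}) ` K)"
    using K(1) by (rule image_compactin)
      (auto simp: continuous_map_componentwise intro: continuous_map_product_projection)
  moreover have "(\<Sum>p\<in>P. a p * f (x(n := q p x))) = 0"
    if x: "x \<in> space (powmeas n) - (\<lambda>x. restrict x {..<n}) ` K" for x
  proof (intro sum.neutral ballI)
    fix p assume "p \<in> P"
    have "x = restrict (x(n := q p x)) {..<n}"
      using x by (auto simp: space_powmeas PiE_def extensional_def restrict_def)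
    then have "x(n := q p x) \<notin> K" using x by blast
    then show "a p * f (x(n := q p x)) = 0"
      using K(2) measurable_space[OF measurable_fun_upd_powmeas[OF q[OF \<open>p \<in> P\<close>]], of x] x by auto
  qed
  ultimately show ?thesis unfolding simple_supported_def by blast
qed

section \<open>Iterated integrals with atomic kernels\<close>

lemma iter_int_cong:
  "(\<And>x. x \<in> space (powmeas n) \<Longrightarrow> f x = g x) \<Longrightarrow> iter_int \<kappa> n f = iter_int \<kappa> n g"
proof (induction n arbitrary: f g)
  case (Suc n)
  have "f (x(n := y)) = g (x(n := y))" if "x \<in> space (powmeas n)" for x y
    using Suc.prems measurable_space[OF measurable_fun_upd_coordinate[OF that], of y] by auto
  then show ?case
    unfolding iter_int.simps by (intro Suc.IH arg_cong[where f = "ring_int _ _"] ext)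
qed (simp add: space_PiM)

lemma iter_int_atomic_Suc:
  assumes f: "simple_supported (Suc n) f" and "finite P"
    and \<kappa>: "\<And>x B. x \<in> space (powmeas n) \<Longrightarrow> \<kappa> n x B = (\<Sum>p\<in>P. a p * indicator B (q p x))"
  shows "iter_int \<kappa> (Suc n) f = iter_int \<kappa> n (\<lambda>x. \<Sum>p\<in>P. a p * f (x(n := q p x)))"
  using assms(2) \<kappa>
  by (simp, intro iter_int_cong)
    (simp add: ring_int_atomic[OF _ _ simple_on_approximable[OF simple_supported_slice[OF f]]])

section \<open>Powers and falling factorials of sums of point masses\<close>

definition point_sum :: "nat \<Rightarrow> (nat \<Rightarrow> 'a) \<Rightarrow> 'a set \<Rightarrow> 'f::real_normed_field" where
  "point_sum m y B = (\<Sum>l<m. indicator B (y l))"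

text \<open>At most one member of a disjoint family contains a given point, so each series has at
  most one nonzero term. The points of \<open>y\<close> may coincide and then count with
  multiplicity.\<close>

lemma point_sum_radon:
  fixes y :: "nat \<Rightarrow> 'a::topological_space"
  shows "(point_sum m y :: 'a set \<Rightarrow> 'f::real_normed_field) \<in> radon_measures"
proof -
  have "(\<lambda>i. indicator (A i) x) sums (indicator (\<Union>i. A i) x :: 'f)" if "disjoint_family A"
    for A :: "nat \<Rightarrow> 'a set" and x
  proof (cases "x \<in> (\<Union>i. A i)")
    case True
    then obtain i where i: "x \<in> A i" by blast
    then have "(\<lambda>j. indicator (A j) x :: 'f) = (\<lambda>j. if j = i then 1 else 0)"
      using that by (intro ext) (auto simp: indicator_def disjoint_family_on_def)
    then show ?thesis using True sums_single[of i "\<lambda>_. 1 :: 'f"] by simp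
  qed (auto simp: indicator_def)
  then show ?thesis
    unfolding radon_measures_def point_sum_def by (auto intro!: sums_sum)
qed

definition distinct_words :: "nat set \<Rightarrow> nat \<Rightarrow> nat list set" where
  "distinct_words J n = {js \<in> words J n. distinct js}"

lemma distinct_words_0 [simp]: "distinct_words J 0 = {[]}"
  by (auto simp: distinct_words_def)

lemma finite_distinct_words: "finite J \<Longrightarrow> finite (distinct_words J n)"
  by (simp add: distinct_words_def finite_words)

lemma sum_words_snoc: "(\<Sum>js\<in>words J (Suc n). f js) = (\<Sum>js\<in>words J n. \<Sum>j\<in>J. f (js @ [j]))"
proof -
  have "(\<Sum>js\<in>words J (Suc n). f js) = (\<Sum>(js, j)\<in>words J n \<times> J. f (js @ [j]))"
    by (rule sum.reindex_bij_witness[of _ "\<lambda>(js, j). js @ [j]" "\<lambda>js. (butlast js, last js)"])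
      (auto simp: words_def length_Suc_conv_rev)
  then show ?thesis by (simp add: sum.cartesian_product)
qed

lemma sum_distinct_words_snoc:
  assumes "finite J"
  shows "(\<Sum>js\<in>distinct_words J (Suc n). f js) = (\<Sum>js\<in>distinct_words J n. \<Sum>j\<in>J - set js. f (js @ [j]))"
proof -
  have "(\<Sum>js\<in>distinct_words J (Suc n). f js) = (\<Sum>(js, j)\<in>Sigma (distinct_words J n) (\<lambda>js. J - set js). f (js @ [j]))"
    by (rule sum.reindex_bij_witness[of _ "\<lambda>(js, j). js @ [j]" "\<lambda>js. (butlast js, last js)"])
      (auto simp: distinct_words_def words_def length_Suc_conv_rev)
  then show ?thesis using assms by (simp add: sum.Sigma finite_distinct_words)
qed

lemma sum_distinct_words_Cons:
  assumes "finite J"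
  shows "(\<Sum>js\<in>distinct_words J (Suc n). f js) = (\<Sum>js\<in>distinct_words J n. \<Sum>j\<in>J - set js. f (j # js))"
proof -
  have "(\<Sum>js\<in>distinct_words J (Suc n). f js) = (\<Sum>(js, j)\<in>Sigma (distinct_words J n) (\<lambda>js. J - set js). f (j # js))"
    by (rule sum.reindex_bij_witness[of _ "\<lambda>(js, j). j # js" "\<lambda>js. (tl js, hd js)"])
      (auto simp: distinct_words_def words_def length_Suc_conv)
  then show ?thesis using assms by (simp add: sum.Sigma finite_distinct_words)
qed

lemma sum_minus_distinct_word:
  fixes g :: "nat \<Rightarrow> 'f::ab_group_add"
  assumes "finite J" "js \<in> distinct_words J n"
  shows "(\<Sum>j\<in>J. g j) - (\<Sum>i<n. g (js ! i)) = (\<Sum>j\<in>J - set js. g j)"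
proof -
  have js: "distinct js" "set js \<subseteq> J" "length js = n"
    using assms(2) by (auto simp: distinct_words_def words_def)
  have "(\<Sum>i<n. g (js ! i)) = (\<Sum>j\<in>set js. g j)"
    using js by (intro sum.reindex_bij_betw bij_betw_nth) auto
  then show ?thesis using js assms(1) by (simp add: sum_diff)
qed

lemma point_Nil [simp]: "point y [] = (\<lambda>_. undefined)"
  by (simp add: point_def fun_eq_iff)

lemma point_snoc: "point y (js @ [l]) = (point y js)(length js := y l)"
  by (auto simp: point_def nth_append)

lemma iter_int_point_sum:
  fixes f :: "(nat \<Rightarrow> 'a::topological_space) \<Rightarrow> 'f::real_normed_field"
  assumes "simple_supported n f"
  shows "iter_int (\<lambda>_ _. point_sum m y) n f = (\<Sum>js\<in>words {..<m} n. f (point y js))"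
  using assms
proof (induction n arbitrary: f)
  case (Suc n)
  let ?g = "\<lambda>x. \<Sum>l<m. 1 * f (x(n := y l))"
  have "iter_int (\<lambda>_ _. point_sum m y) (Suc n) f = iter_int (\<lambda>_ _. point_sum m y) n ?g"
    by (rule iter_int_atomic_Suc[OF Suc.prems]) (auto simp: point_sum_def)
  also have "\<dots> = (\<Sum>js\<in>words {..<m} n. ?g (point y js))"
    by (intro Suc.IH simple_supported_step[OF Suc.prems]) auto
  also have "\<dots> = (\<Sum>js\<in>words {..<m} (Suc n). f (point y js))"
    unfolding sum_words_snoc by (intro sum.cong refl) (auto simp: point_snoc words_def)
  finally show ?case .
qed simp

text \<open>Each kernel deletes the atoms chosen before, so only words with distinct letters
  survive. Distinctness concerns the letters and not the points: atoms at the same place are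
  different letters.\<close>

lemma iter_int_falling_point_sum:
  fixes f :: "(nat \<Rightarrow> 'a::topological_space) \<Rightarrow> 'f::real_normed_field"
  assumes "simple_supported n f"
  shows "iter_int (\<lambda>j x B. point_sum m y B - (\<Sum>i<j. indicator B (x i))) n f
    = (\<Sum>js\<in>distinct_words {..<m} n. f (point y js))"
  using assms
proof (induction n arbitrary: f)
  case (Suc n)
  let ?\<kappa> = "\<lambda>j x B. point_sum m y B - (\<Sum>i<j. indicator B (x i)) :: 'f"
  \<comment> \<open>\<open>Inl l\<close> indexes the atom at \<open>y l\<close> with weight 1, and
    \<open>Inr i\<close> the earlier coordinate \<open>x i\<close> with weight -1.\<close>
  let ?a = "case_sum (\<lambda>_. 1) (\<lambda>_. - 1) :: nat + nat \<Rightarrow> 'f"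
  let ?q = "\<lambda>p x. case_sum y x p"
  let ?P = "{..<m} <+> {..<n}"
  let ?g = "\<lambda>x. \<Sum>p\<in>?P. ?a p * f (x(n := ?q p x))"
  have "iter_int ?\<kappa> (Suc n) f = iter_int ?\<kappa> n ?g"
    by (rule iter_int_atomic_Suc[OF Suc.prems]) (simp_all add: point_sum_def sum.Plus sum_negf comp_def del: sum_mult_indicator)
  also have "\<dots> = (\<Sum>js\<in>distinct_words {..<m} n. ?g (point y js))"
    by (intro Suc.IH simple_supported_step[OF Suc.prems]) (auto simp: measurable_component_singleton)
  also have "\<dots> = (\<Sum>js\<in>distinct_words {..<m} (Suc n). f (point y js))"
    unfolding sum_distinct_words_snoc[OF finite_lessThan]
  proof (intro sum.cong refl)
    fix js assume js: "js \<in> distinct_words {..<m} n"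
    then have len: "length js = n" by (simp add: distinct_words_def words_def)
    then have "?g (point y js) = (\<Sum>l<m. f (point y (js @ [l]))) - (\<Sum>i<n. f (point y (js @ [js ! i])))"
      unfolding point_snoc by (simp add: sum.Plus sum_negf, simp add: point_def)
    also have "\<dots> = (\<Sum>l\<in>{..<m} - set js. f (point y (js @ [l])))"
      using js by (intro sum_minus_distinct_word) auto
    finally show "?g (point y js) = \<dots>" .
  qed
  finally show ?case .
qed simp

lemma simple_supported_indicator:
  assumes "B \<in> rc_sets (powtop n) (powmeas n)"
  shows "simple_supported n (indicator B)"
  using assms by (auto simp: rc_sets_def simple_supported_def indicator_def split: if_splits)

lemma pow_int_tensor_power:
  fixes f :: "(nat \<Rightarrow> 'a::topological_space) \<Rightarrow> 'f::{real_normed_field, euclidean_space}"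
  assumes "f \<in> bmc (powtop n) (powmeas n)"
  shows "pow_int n (tensor_power (point_sum m y) n) f = (\<Sum>js\<in>words {..<m} n. f (point y js))"
  using ring_int_atomic[of "words {..<m} n" "rc_sets (powtop n) (powmeas n)"
      "tensor_power (point_sum m y) n" "\<lambda>_. 1" "point y" f]
    bmc_approximable[OF assms compactin_powtop_subset]
  by (simp add: tensor_power_def iter_int_point_sum simple_supported_indicator finite_words)

lemma pow_int_falling_factorial:
  fixes f :: "(nat \<Rightarrow> 'a::topological_space) \<Rightarrow> 'f::{real_normed_field, euclidean_space}"
  assumes "f \<in> bmc (powtop n) (powmeas n)"
  shows "pow_int n (falling_factorial (point_sum m y) n) f = (\<Sum>js\<in>distinct_words {..<m} n. f (point y js))"
  using ring_int_atomic[of "distinct_words {..<m} n" "rc_sets (powtop n) (powmeas n)"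
      "falling_factorial (point_sum m y) n" "\<lambda>_. 1" "point y" f]
    bmc_approximable[OF assms compactin_powtop_subset]
  by (simp add: falling_factorial_def iter_int_falling_point_sum simple_supported_indicator
      finite_distinct_words)

subsection \<open>Determination of the Stirling operators\<close>

lemma tensor_Cons_point:
  "length js = length \<eta>s \<Longrightarrow> tensor (\<xi> # \<eta>s) (point y (j # js)) = \<xi> (y j) * tensor \<eta>s (point y js)"
  by (simp add: tensor_point prod.lessThan_Suc_shift del: prod.lessThan_Suc)

lemma tensor_absorb_point:
  assumes "length js = length \<eta>s" "i < length \<eta>s"
  shows "tensor (absorb \<xi> \<eta>s i) (point y js) = \<xi> (y (js ! i)) * tensor \<eta>s (point y js)"
proof -
  let ?I = "{..<length \<eta>s}"
  have "tensor (absorb \<xi> \<eta>s i) (point y js) = (\<Prod>j\<in>?I. (absorb \<xi> \<eta>s i ! j) (y (js ! j)))"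
    using assms by (simp add: tensor_point)
  also have "\<dots> = \<xi> (y (js ! i)) * (\<eta>s ! i) (y (js ! i)) * (\<Prod>j\<in>?I - {i}. (\<eta>s ! j) (y (js ! j)))"
    using assms by (subst prod.remove[of _ i]) (auto simp: absorb_def intro!: prod.cong)
  also have "\<dots> = \<xi> (y (js ! i)) * (\<Prod>j\<in>?I. (\<eta>s ! j) (y (js ! j)))"
    using assms by (subst (2) prod.remove[of _ i]) (auto simp: mult.assoc)
  finally show ?thesis using assms by (simp add: tensor_point)
qed

text \<open>Multiplication by the integral of \<open>\<xi>\<close> against
  \<open>point_sum m y\<close>. Acting on the scalar field itself, it makes the Wick calculus
  available for measures.\<close>

definition point_operator :: "nat \<Rightarrow> (nat \<Rightarrow> 'a) \<Rightarrow> ('a \<Rightarrow> 'f) \<Rightarrow> 'f \<Rightarrow> 'f::real_normed_field" where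
  "point_operator m y \<xi> v = (\<Sum>l<m. \<xi> (y l)) * v"

interpretation point_operator: commuting_operators UNIV "point_operator m y" for m y
  by unfold_locales (auto simp: point_operator_def algebra_simps)

lemma wick_point_operator:
  "wick (point_operator m y) \<eta>s v
    = (\<Sum>js\<in>distinct_words {..<m} (length \<eta>s). tensor \<eta>s (point y js)) * v"
proof (induction "length \<eta>s" arbitrary: \<eta>s rule: less_induct)
  case less
  show ?case
  proof (cases \<eta>s)
    case Nil
    then show ?thesis by (simp add: tensor_def)
  next
    case (Cons \<xi> \<zeta>s)
    let ?n = "length \<zeta>s"
    let ?D = "distinct_words {..<m} ?n"
    have len: "length js = ?n" if "js \<in> ?D" for js using that by (simp add: distinct_words_def words_def)
    have "(\<Sum>js\<in>distinct_words {..<m} (Suc ?n). tensor (\<xi> # \<zeta>s) (point y js))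
        = (\<Sum>js\<in>?D. \<Sum>l\<in>{..<m} - set js. \<xi> (y l) * tensor \<zeta>s (point y js))"
      by (simp add: sum_distinct_words_Cons tensor_Cons_point len)
    also have "\<dots> = (\<Sum>js\<in>?D. (\<Sum>l<m. \<xi> (y l)) * tensor \<zeta>s (point y js)
        - (\<Sum>i<?n. tensor (absorb \<xi> \<zeta>s i) (point y js)))"
      by (intro sum.cong refl)
        (simp add: sum_minus_distinct_word[symmetric] tensor_absorb_point len
          left_diff_distrib flip: sum_distrib_right)
    also have "\<dots> = (\<Sum>l<m. \<xi> (y l)) * (\<Sum>js\<in>?D. tensor \<zeta>s (point y js))
        - (\<Sum>i<?n. \<Sum>js\<in>?D. tensor (absorb \<xi> \<zeta>s i) (point y js))"
      by (simp add: sum_subtractf sum_distrib_left sum.swap[of _ "{..<?n}"])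
    finally show ?thesis
      using less Cons
      by (simp add: point_operator.wick_Cons left_diff_distrib sum_distrib_right[symmetric] mult.assoc
          point_operator_def[of _ _ \<xi>])
  qed
qed

lemma foldr_point_operator:
  "foldr (\<circ>) (map (point_operator m y) \<xi>s) id v
    = (\<Sum>js\<in>words {..<m} (length \<xi>s). tensor \<xi>s (point y js)) * v"
proof (induction \<xi>s)
  case (Cons \<xi> \<xi>s)
  have "(\<Sum>js\<in>words {..<m} (Suc (length \<xi>s)). tensor (\<xi> # \<xi>s) (point y js))
      = (\<Sum>l<m. \<Sum>js\<in>words {..<m} (length \<xi>s). \<xi> (y l) * tensor \<xi>s (point y js))"
    unfolding sum_words_Suc by (intro sum.cong refl) (auto simp: words_def tensor_Cons_point)
  also have "\<dots> = (\<Sum>l<m. \<xi> (y l)) * (\<Sum>js\<in>words {..<m} (length \<xi>s). tensor \<xi>s (point y js))"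
    by (simp add: sum_product)
  finally show ?case using Cons by (simp add: point_operator_def[of _ _ \<xi>] mult.assoc)
qed (simp add: tensor_def)

text \<open>The partition identity for the scalar operators, applied to 1: the tensor power of a sum
  of point masses expressed through its falling factorials.\<close>

lemma sum_tensor_words:
  "(\<Sum>js\<in>words {..<m} (length \<xi>s). tensor \<xi>s (point y js))
    = (\<Sum>\<eta>s\<leftarrow>block_products \<xi>s. \<Sum>js\<in>distinct_words {..<m} (length \<eta>s). tensor \<eta>s (point y js))"
  using point_operator.foldr_eq_sum_wick[of \<xi>s m y 1]
  by (simp add: foldr_point_operator wick_point_operator)

section \<open>Symmetrization and grouping by the number of blocks\<close>

lemma point_permute_list:
  assumes "\<pi> permutes {..<length js}"
  shows "point y (permute_list \<pi> js) = point y js \<circ> \<pi>"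
proof
  fix i
  have "\<pi> i < length js \<longleftrightarrow> i < length js" using permutes_in_image[OF assms, of i] by simp
  then show "point y (permute_list \<pi> js) i = (point y js \<circ> \<pi>) i"
    using assms by (simp add: point_def permute_list_nth)
qed

lemma permute_list_inv:
  assumes "\<pi> permutes {..<length js}"
  shows "permute_list (inv \<pi>) (permute_list \<pi> js) = js" "permute_list \<pi> (permute_list (inv \<pi>) js) = js"
  using permute_list_compose[OF permutes_inv[OF assms], of \<pi>] permute_list_compose[OF assms, of "inv \<pi>"]
  by (simp_all add: permutes_inv_o[OF assms])

text \<open>Permuting coordinates only reindexes a family of words closed under permutation, so all
  \<open>fact n\<close> summands of the symmetrization contribute equally.\<close>

lemma sum_symmetrize:
  assumes len: "\<And>js. js \<in> J \<Longrightarrow> length js = n"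
    and J: "\<And>js \<pi>. js \<in> J \<Longrightarrow> \<pi> permutes {..<n} \<Longrightarrow> permute_list \<pi> js \<in> J"
  shows "(\<Sum>js\<in>J. symmetrize n f (point y js)) = (\<Sum>js\<in>J. f (point y js))"
proof -
  have perm: "(\<Sum>js\<in>J. f (point y js \<circ> \<pi>)) = (\<Sum>js\<in>J. f (point y js))" if \<pi>: "\<pi> permutes {..<n}" for \<pi>
    by (rule sum.reindex_bij_witness[of _ "permute_list (inv \<pi>)" "permute_list \<pi>"])
      (use \<pi> len J permutes_inv[OF \<pi>] in \<open>auto simp: permute_list_inv point_permute_list\<close>)
  have "(\<Sum>js\<in>J. symmetrize n f (point y js))
      = (\<Sum>\<pi> | \<pi> permutes {..<n}. \<Sum>js\<in>J. f (point y js \<circ> \<pi>)) / fact n"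
    unfolding symmetrize_def sum_divide_distrib[symmetric] by (subst sum.swap) simp
  also have "\<dots> = (\<Sum>\<pi> | \<pi> permutes {..<n}. \<Sum>js\<in>J. f (point y js)) / fact n"
    by (simp add: perm)
  finally show ?thesis by (simp add: card_permutations)
qed

lemma permute_list_words: "js \<in> words J n \<Longrightarrow> \<pi> permutes {..<n} \<Longrightarrow> permute_list \<pi> js \<in> words J n"
  by (auto simp: words_def)

lemma permute_list_distinct_words:
  "js \<in> distinct_words J n \<Longrightarrow> \<pi> permutes {..<n} \<Longrightarrow> permute_list \<pi> js \<in> distinct_words J n"
  by (auto simp: distinct_words_def words_def)

lemma sum_sum_list_swap: "(\<Sum>i\<in>I. \<Sum>x\<leftarrow>xs. f i x) = (\<Sum>x\<leftarrow>xs. \<Sum>i\<in>I. f i x)"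
  for f :: "_ \<Rightarrow> _ \<Rightarrow> 'b::comm_monoid_add"
  by (induction xs) (simp_all add: sum.distrib)

lemma sum_filter_eq:
  fixes f :: "'b \<Rightarrow> 'c::comm_monoid_add"
  assumes "finite K" "\<And>x. x \<in> set xs \<Longrightarrow> g x \<in> K"
  shows "(\<Sum>k\<in>K. \<Sum>x\<leftarrow>filter (\<lambda>x. g x = k) xs. f x) = (\<Sum>x\<leftarrow>xs. f x)"
proof -
  have "(\<Sum>x\<leftarrow>filter (\<lambda>x. g x = k) xs. f x) = (\<Sum>x\<leftarrow>xs. if g x = k then f x else 0)" for k
    by (simp add: sum_list_map_filter')
  then have "(\<Sum>k\<in>K. \<Sum>x\<leftarrow>filter (\<lambda>x. g x = k) xs. f x) = (\<Sum>x\<leftarrow>xs. \<Sum>k\<in>K. if g x = k then f x else 0)"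
    by (simp add: sum_sum_list_swap)
  also have "\<dots> = (\<Sum>x\<leftarrow>xs. f x)"
    using assms by (intro arg_cong[where f = sum_list] map_cong refl) simp
  finally show ?thesis .
qed

text \<open>The sum over partitions into exactly \<open>k\<close> blocks; its symmetrization will be
  the value of the Stirling operator \<open>S n k\<close> at the symmetrized tensor product.\<close>

definition block_tensor :: "('a \<Rightarrow> 'f) list \<Rightarrow> nat \<Rightarrow> (nat \<Rightarrow> 'a) \<Rightarrow> 'f::real_normed_field" where
  "block_tensor \<xi>s k x = (\<Sum>\<eta>s\<leftarrow>filter (\<lambda>\<eta>s. length \<eta>s = k) (block_products \<xi>s). tensor \<eta>s x)"

text \<open>With as many atoms as coordinates, the distinct words are the rearrangements of
  \<open>[0..<k]\<close>, so a symmetric function is recovered at the single point \<open>x\<close>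
  up to a factor.\<close>

lemma sum_symmetric_distinct_words:
  assumes g: "\<And>\<pi> x. \<pi> permutes {..<k} \<Longrightarrow> g (x \<circ> \<pi>) = g x" and x: "x \<in> space (powmeas k)"
  shows "(\<Sum>js\<in>distinct_words {..<k} k. g (point x js)) = of_nat (card (distinct_words {..<k} k)) * g x"
proof -
  have x_eq: "point x [0..<k] = x"
    using x by (auto simp: point_def fun_eq_iff space_powmeas PiE_def extensional_def)
  have "g (point x js) = g x" if js: "js \<in> distinct_words {..<k} k" for js
  proof -
    have "set js = {..<k}"
      using js by (intro card_subset_eq) (auto simp: distinct_words_def words_def distinct_card)
    then have "mset js = mset [0..<k]"
      using js set_eq_iff_mset_eq_distinct[of js "[0..<k]"]
      by (simp add: distinct_words_def atLeast0LessThan)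
    then obtain \<pi> where "\<pi> permutes {..<length [0..<k]}" "permute_list \<pi> [0..<k] = js"
      by (rule mset_eq_permutation)
    then show ?thesis using g point_permute_list[of \<pi> "[0..<k]" x] by (auto simp: x_eq)
  qed
  then show ?thesis by simp
qed

text \<open>By the pigeonhole principle, a falling factorial of order above the number of atoms is
  zero.\<close>

lemma distinct_words_empty: "m < k \<Longrightarrow> distinct_words {..<m} k = {}"
  by (auto simp: distinct_words_def words_def) (metis card_lessThan card_mono distinct_card
      finite_lessThan leD)

text \<open>Strong induction on \<open>k\<close>, testing the defining identity with the point
  masses at the \<open>k\<close> coordinates of \<open>x\<close>. Terms of higher order vanish,
  those of lower order agree by induction, and the term of order \<open>k\<close> determines the
  value at \<open>x\<close>.\<close>

lemma stirling_operator_sym_tensor: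
  fixes \<xi>s :: "('a::topological_space \<Rightarrow> 'f::{real_normed_field, euclidean_space}) list"
  assumes S: "stirling_operators S" and \<xi>s: "set \<xi>s \<subseteq> bmc1" "length \<xi>s = n"
    and "k \<in> {1..n}"
  shows "S n k (sym_tensor \<xi>s) = symmetrize k (block_tensor \<xi>s k)"
  using \<open>k \<in> {1..n}\<close>
proof (induction k rule: less_induct)
  case (less k)
  let ?f = "sym_tensor \<xi>s"
  let ?T = "\<lambda>j. symmetrize j (block_tensor \<xi>s j)"
  have n: "1 \<le> n" using less.prems by simp
  have f: "?f \<in> bmc_sym n" using sym_tensor_in_bmc_sym[OF \<xi>s(1)] \<xi>s(2) by simp
  have Sj: "S n j ?f \<in> bmc_sym j" if "j \<in> {1..n}" for j
    using S n that f by (auto simp: stirling_operators_def)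
  show ?case
  proof
    fix x
    show "S n k ?f x = ?T k x"
    proof (cases "x \<in> space (powmeas k)")
      \<comment> \<open>Off the power of the space the right side vanishes by the extensionality
        test in \<open>tensor\<close>, the left side because its compact support lies in that
        space.\<close>
      case False
      have "block_tensor \<xi>s k (x \<circ> \<pi>) = 0" if \<pi>: "\<pi> permutes {..<k}" for \<pi>
      proof -
        have "tensor \<eta>s (x \<circ> \<pi>) = 0" if "length \<eta>s = k" for \<eta>s :: "('a \<Rightarrow> 'f) list"
          using tensor_comp_permutation[of \<pi> \<eta>s x] \<pi> that False
          by (simp add: tensor_def space_powmeas PiE_def)
        then have "map (\<lambda>\<eta>s. tensor \<eta>s (x \<circ> \<pi>)) (filter (\<lambda>\<eta>s. length \<eta>s = k) (block_products \<xi>s))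
            = map (\<lambda>_. 0) (filter (\<lambda>\<eta>s. length \<eta>s = k) (block_products \<xi>s))"
          by (intro map_cong refl) simp
        then show ?thesis by (simp only: block_tensor_def sum_list_0)
      qed
      moreover have "S n k ?f x = 0"
        using Sj[OF less.prems] False compactin_powtop_subset[of k] by (fastforce simp: bmc_sym_def bmc_def)
      ultimately show ?thesis by (simp add: symmetrize_def)
    next
      case x: True
      \<comment> \<open>For the measure \<open>point_sum k x\<close>, \<open>?a j\<close> is the
        \<open>j\<close>-th term of the defining identity and \<open>?b j\<close> is the same term
        with the claimed value of the operator.\<close>
      let ?D = "distinct_words {..<k}"
      let ?a = "\<lambda>j. \<Sum>js\<in>?D j. S n j ?f (point x js)"
      let ?b = "\<lambda>j. \<Sum>js\<in>?D j. ?T j (point x js)"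
      have "(\<Sum>j=1..n. ?a j) = (\<Sum>j=1..n. pow_int j (falling_factorial (point_sum k x) j) (S n j ?f))"
        using Sj by (intro sum.cong refl pow_int_falling_factorial[symmetric]) (auto simp: bmc_sym_def)
      also have "\<dots> = pow_int n (tensor_power (point_sum k x) n) ?f"
        using S[unfolded stirling_operators_def, THEN conjunct2, rule_format, OF n point_sum_radon f]
        by (rule sym)
      also have "\<dots> = (\<Sum>js\<in>words {..<k} n. ?f (point x js))"
        using f by (intro pow_int_tensor_power) (auto simp: bmc_sym_def)
      also have "\<dots> = (\<Sum>js\<in>words {..<k} n. tensor \<xi>s (point x js))"
        unfolding sym_tensor_def \<xi>s(2)
        by (rule sum_symmetrize[OF _ permute_list_words]) (auto simp: words_def)
      also have "\<dots> = (\<Sum>\<eta>s\<leftarrow>block_products \<xi>s. \<Sum>js\<in>?D (length \<eta>s). tensor \<eta>s (point x js))"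
        using sum_tensor_words[where m = k and \<xi>s = \<xi>s and y = x] \<xi>s(2) by simp
      also have "\<dots> = (\<Sum>j=1..n. \<Sum>\<eta>s\<leftarrow>filter (\<lambda>\<eta>s. length \<eta>s = j) (block_products \<xi>s).
          \<Sum>js\<in>?D (length \<eta>s). tensor \<eta>s (point x js))"
        using length_block_products[of _ \<xi>s] \<xi>s(2) n
        by (intro sum_filter_eq[symmetric]) (auto simp: Suc_le_eq)
      also have "\<dots> = (\<Sum>j=1..n. \<Sum>js\<in>?D j. block_tensor \<xi>s j (point x js))"
        unfolding block_tensor_def sum_sum_list_swap
        by (intro sum.cong refl arg_cong[where f = sum_list] map_cong) auto
      also have "\<dots> = (\<Sum>j=1..n. ?b j)"
        by (intro sum.cong refl sum_symmetrize[symmetric] permute_list_distinct_words)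
          (auto simp: distinct_words_def words_def)
      finally have "(\<Sum>j=1..n. ?a j) = (\<Sum>j=1..n. ?b j)" .
      \<comment> \<open>Below \<open>k\<close> this is the induction hypothesis; above
        \<open>k\<close> both sums are empty.\<close>
      moreover have "?a j = ?b j" if "j \<in> {1..n} - {k}" for j
        using that less.IH[of j] by (cases j k rule: linorder_cases) (auto simp: distinct_words_empty)
      then have "(\<Sum>j\<in>{1..n} - {k}. ?a j) = (\<Sum>j\<in>{1..n} - {k}. ?b j)"
        by (rule sum.cong[OF refl])
      ultimately have "?a k = ?b k"
        using sum.remove[OF _ less.prems, of ?a] sum.remove[OF _ less.prems, of ?b] by simp
      moreover have "?a k = of_nat (card (?D k)) * S n k ?f x"
        by (rule sum_symmetric_distinct_words[OF bmc_symD[OF Sj[OF less.prems]] x])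
      moreover have "?b k = of_nat (card (?D k)) * ?T k x"
        by (rule sum_symmetric_distinct_words[OF symmetrize_permutation x])
      \<comment> \<open>One distinct word suffices to make the common factor nonzero, so it can be
        cancelled.\<close>
      moreover have "[0..<k] \<in> ?D k" by (auto simp: distinct_words_def words_def)
      then have "card (?D k) \<noteq> 0" by (auto simp: finite_distinct_words)
      ultimately show ?thesis by simp
    qed
  qed
qed

text \<open>Symmetrization averages tensor products with permuted factors, and these have equal Wick
  products, so the average disappears.\<close>

lemma (in linear_wick_operators) wick_int_symmetrize:
  assumes \<eta>ss: "\<And>\<eta>s. \<eta>s \<in> set \<eta>ss \<Longrightarrow> length \<eta>s = k \<and> set \<eta>s \<subseteq> bmc1" and A: "A = bmc1"
  shows "wick_int smul \<rho> k (symmetrize k (\<lambda>x. \<Sum>\<eta>s\<leftarrow>\<eta>ss. tensor \<eta>s x)) = (\<lambda>v. \<Sum>\<eta>s\<leftarrow>\<eta>ss. wick \<rho> \<eta>s v)"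
proof -
  let ?perms = "{\<pi>. \<pi> permutes {..<k}}"
  obtain \<pi>s where \<pi>s: "set \<pi>s = ?perms" "distinct \<pi>s"
    using finite_distinct_list[OF finite_permutations[of "{..<k}"]] by auto
  \<comment> \<open>The symmetrized function as an explicit linear combination of tensor products;
    the inverses come from \<open>tensor_comp_permutation\<close>.\<close>
  define ts where "ts = concat (map (\<lambda>\<eta>s. map (\<lambda>\<pi>. (1 / fact k :: 'f, permute_list (inv \<pi>) \<eta>s)) \<pi>s) \<eta>ss)"
  have sum_ts: "(\<Sum>(c, \<xi>s)\<leftarrow>ts. F c \<xi>s) = (\<Sum>\<eta>s\<leftarrow>\<eta>ss. \<Sum>\<pi>\<in>?perms. F (1 / fact k) (permute_list (inv \<pi>) \<eta>s))"
    for F :: "'f \<Rightarrow> ('a \<Rightarrow> 'f) list \<Rightarrow> 'b::comm_monoid_add"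
    by (simp add: ts_def sum_list_concat_map comp_def sum_list_distinct_conv_sum_set \<pi>s)
  have "symmetrize k (\<lambda>x. \<Sum>\<eta>s\<leftarrow>\<eta>ss. tensor \<eta>s x) x = (\<Sum>(c, \<xi>s)\<leftarrow>ts. c * tensor \<xi>s x)" for x
  proof -
    have "symmetrize k (\<lambda>x. \<Sum>\<eta>s\<leftarrow>\<eta>ss. tensor \<eta>s x) x
        = (\<Sum>\<eta>s\<leftarrow>\<eta>ss. (\<Sum>\<pi>\<in>?perms. 1 / fact k * tensor \<eta>s (x \<circ> \<pi>)))"
      unfolding symmetrize_def sum_sum_list_swap
      by (simp add: sum_distrib_left[symmetric] sum_list_const_mult[symmetric] divide_inverse mult.commute)
    also have "\<dots> = (\<Sum>\<eta>s\<leftarrow>\<eta>ss. (\<Sum>\<pi>\<in>?perms. 1 / fact k * tensor (permute_list (inv \<pi>) \<eta>s) x))"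
      using \<eta>ss by (intro arg_cong[where f = sum_list] map_cong refl sum.cong)
        (auto simp: tensor_comp_permutation)
    finally show ?thesis by (simp add: sum_ts)
  qed
  moreover have "\<forall>(c, \<xi>s)\<in>set ts. length \<xi>s = k \<and> set \<xi>s \<subseteq> bmc1"
    using \<eta>ss \<pi>s(1) by (auto simp: ts_def permutes_inv)
  ultimately have "wick_int smul \<rho> k (symmetrize k (\<lambda>x. \<Sum>\<eta>s\<leftarrow>\<eta>ss. tensor \<eta>s x))
      = (\<lambda>v. \<Sum>(c, \<xi>s)\<leftarrow>ts. smul c (wick \<rho> \<xi>s v))"
    using wick_int_eq[of ts k] A by presburger
  also have "\<dots> = (\<lambda>v. \<Sum>\<eta>s\<leftarrow>\<eta>ss. wick \<rho> \<eta>s v)"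
  proof
    fix v
    have "(\<Sum>\<pi>\<in>?perms. smul (1 / fact k) (wick \<rho> (permute_list (inv \<pi>) \<eta>s) v)) = wick \<rho> \<eta>s v"
      if "\<eta>s \<in> set \<eta>ss" for \<eta>s
    proof -
      have "wick \<rho> (permute_list (inv \<pi>) \<eta>s) v = wick \<rho> \<eta>s v" if "\<pi> \<in> ?perms" for \<pi>
        using that \<eta>ss[OF \<open>\<eta>s \<in> set \<eta>ss\<close>] A by (intro wick_mset_cong[symmetric]) (auto simp: permutes_inv)
      then have "(\<Sum>\<pi>\<in>?perms. smul (1 / fact k) (wick \<rho> (permute_list (inv \<pi>) \<eta>s) v))
          = smul (\<Sum>\<pi>\<in>?perms. 1 / fact k) (wick \<rho> \<eta>s v)"
        unfolding scale_sum_left by (intro sum.cong refl) simp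
      then show ?thesis by (simp add: card_permutations)
    qed
    then show "(\<Sum>(c, \<xi>s)\<leftarrow>ts. smul c (wick \<rho> \<xi>s v)) = (\<Sum>\<eta>s\<leftarrow>\<eta>ss. wick \<rho> \<eta>s v)"
      unfolding sum_ts by (intro arg_cong[where f = sum_list] map_cong refl)
  qed
  finally show ?thesis .
qed

theorem theorem7p6:
  fixes \<sigma> :: "'a::polish_space set \<Rightarrow> 'f::{real_normed_field, euclidean_space}"
    and smul :: "'f \<Rightarrow> 'v::ab_group_add \<Rightarrow> 'v"
    and ap am \<rho> :: "('a \<Rightarrow> 'f) \<Rightarrow> 'v \<Rightarrow> 'v"
    and S :: "nat \<Rightarrow> nat \<Rightarrow> ((nat \<Rightarrow> 'a) \<Rightarrow> 'f) \<Rightarrow> (nat \<Rightarrow> 'a) \<Rightarrow> 'f"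
    and n :: nat and \<xi>s :: "('a \<Rightarrow> 'f) list"
  assumes "locally_compact_space (euclidean :: 'a topology)"
    and "\<sigma> \<in> radon_measures"
    and "vector_space smul"
    and "linear_operators smul ap" "linear_operators smul am" "linear_operators smul \<rho>"
    and "\<And>\<phi> \<xi>. \<phi> \<in> bmc1 \<Longrightarrow> \<xi> \<in> bmc1 \<Longrightarrow> commutator (ap \<phi>) (ap \<xi>) = (\<lambda>v. 0)"
    and "\<And>\<phi> \<xi>. \<phi> \<in> bmc1 \<Longrightarrow> \<xi> \<in> bmc1 \<Longrightarrow> commutator (am \<phi>) (am \<xi>) = (\<lambda>v. 0)"
    and "\<And>\<phi> \<xi>. \<phi> \<in> bmc1 \<Longrightarrow> \<xi> \<in> bmc1 \<Longrightarrow>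
           commutator (am \<phi>) (ap \<xi>) = smul (meas_int \<sigma> (\<lambda>x. \<phi> x * \<xi> x))"
    and "\<And>\<phi> \<xi>. \<phi> \<in> bmc1 \<Longrightarrow> \<xi> \<in> bmc1 \<Longrightarrow> commutator (\<rho> \<phi>) (\<rho> \<xi>) = (\<lambda>v. 0)"
    and "\<And>\<phi> \<xi>. \<phi> \<in> bmc1 \<Longrightarrow> \<xi> \<in> bmc1 \<Longrightarrow> commutator (\<rho> \<phi>) (ap \<xi>) = ap (\<lambda>x. \<phi> x * \<xi> x)"
    and "\<And>\<phi> \<xi>. \<phi> \<in> bmc1 \<Longrightarrow> \<xi> \<in> bmc1 \<Longrightarrow> commutator (am \<xi>) (\<rho> \<phi>) = am (\<lambda>x. \<phi> x * \<xi> x)"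
    and "stirling_operators S"
    and "n \<ge> 1" and "length \<xi>s = n" and "set \<xi>s \<subseteq> bmc1"
  shows "foldr (\<circ>) (map \<rho> \<xi>s) id = (\<lambda>v. \<Sum>k=1..n. wick_int smul \<rho> k (S n k (sym_tensor \<xi>s)) v)"
proof
  fix v
  interpret V: vector_space smul by fact
  have lin: "Vector_Spaces.linear smul smul (\<rho> \<xi>)" if "\<xi> \<in> bmc1" for \<xi>
    using assms(6) that by (simp add: linear_operators_def)
  have commute: "\<rho> \<phi> (\<rho> \<xi> w) = \<rho> \<xi> (\<rho> \<phi> w)" if "\<phi> \<in> bmc1" "\<xi> \<in> bmc1" for \<phi> \<xi> w
    using fun_cong[OF assms(10)[OF that], of w] by (simp add: commutator_def)
  interpret W: linear_wick_operators bmc1 \<rho> smul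
  proof
    show "\<rho> \<xi> (w + w') = \<rho> \<xi> w + \<rho> \<xi> w'" if "\<xi> \<in> bmc1" for \<xi> w w'
      using lin[OF that] by (simp add: Vector_Spaces.linear_iff)
    show "\<rho> \<phi> (\<rho> \<xi> w) = \<rho> \<xi> (\<rho> \<phi> w)" if "\<phi> \<in> bmc1" "\<xi> \<in> bmc1" for \<phi> \<xi> w
      using that by (rule commute)
    show "\<rho> (\<lambda>x. \<phi> x + \<xi> x) w = \<rho> \<phi> w + \<rho> \<xi> w" if "\<phi> \<in> bmc1" "\<xi> \<in> bmc1" for \<phi> \<xi> w
      using assms(6) that by (simp add: linear_operators_def)
    show "\<rho> (\<lambda>x. c * \<xi> x) w = smul c (\<rho> \<xi> w)" if "\<xi> \<in> bmc1" for c \<xi> w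
      using assms(6) that by (simp add: linear_operators_def)
  qed (auto simp: bmc_0 intro: bmc_add bmc_mult bmc_scale)
  let ?B = "\<lambda>k. filter (\<lambda>\<eta>s. length \<eta>s = k) (block_products \<xi>s)"
  have "wick_int smul \<rho> k (S n k (sym_tensor \<xi>s)) v = (\<Sum>\<eta>s\<leftarrow>?B k. wick \<rho> \<eta>s v)"
    if "k \<in> {1..n}" for k
  proof -
    have "S n k (sym_tensor \<xi>s) = symmetrize k (\<lambda>x. \<Sum>\<eta>s\<leftarrow>?B k. tensor \<eta>s x)"
      using stirling_operator_sym_tensor[OF assms(13,16,15) that] by (simp add: block_tensor_def[abs_def])
    moreover have "wick_int smul \<rho> k (symmetrize k (\<lambda>x. \<Sum>\<eta>s\<leftarrow>?B k. tensor \<eta>s x))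
        = (\<lambda>v. \<Sum>\<eta>s\<leftarrow>?B k. wick \<rho> \<eta>s v)"
      using W.block_products_closed[OF assms(16)] by (intro W.wick_int_symmetrize) auto
    ultimately show ?thesis by simp
  qed
  then have "(\<Sum>k=1..n. wick_int smul \<rho> k (S n k (sym_tensor \<xi>s)) v)
      = (\<Sum>k=1..n. \<Sum>\<eta>s\<leftarrow>?B k. wick \<rho> \<eta>s v)" by (intro sum.cong refl)
  \<comment> \<open>Since \<open>n \<ge> 1\<close>, every partition has between 1 and
    \<open>n\<close> blocks, so the sum over \<open>k\<close> exhausts them all.\<close>
  also have "\<dots> = (\<Sum>\<eta>s\<leftarrow>block_products \<xi>s. wick \<rho> \<eta>s v)"
    using length_block_products[of _ \<xi>s] assms(14,15)
    by (intro sum_filter_eq) (auto simp: Suc_le_eq)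
  also have "\<dots> = foldr (\<circ>) (map \<rho> \<xi>s) id v"
    using W.foldr_eq_sum_wick[OF assms(16)] by simp
  finally show "foldr (\<circ>) (map \<rho> \<xi>s) id v = (\<Sum>k=1..n. wick_int smul \<rho> k (S n k (sym_tensor \<xi>s)) v)"
    by simp
qed

end
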